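(* Let $k\ge 1$ be an integer, and for every integer $n\ge 1$ put $\mathcal{S}_{k,n}=\{m\in\mathcal{A}_k\cup\mathcal{B}_k: m\ge n\}$. Then, for every $n\ge 1$, $$\mathcal{D}_k(n)=\min \mathcal{S}_{k,n}\quad\text{if } k\not\equiv 1\pmod 3.$$ Next suppose that $k\equiv 1\pmod 3$, $k\not\equiv 2\pmod 5$, $k\not\equiv 6\pmod{25}$ and $k\not\equiv 18\pmod{25}$. Then, for every $n\ge 1$, $$\mathcal{D}_k(n)=\begin{cases}\min \mathcal{S}_{k,n} & \text{if } k\equiv 0 \text{ or } 4\pmod 5,\\ \min\big(\mathcal{S}_{k,n}\cup\{m\ge 5n/3: m\in\mathcal{B}_{5,k}\}\big) & \text{if } k\equiv 1\pmod 5,\\ \min\big(\mathcal{S}_{k,n}\cup\{m\ge 5n/3: m\in\mathcal{A}_{5,k}\cup\mathcal{B}_{5,k}\}\big) & \text{if } k\equiv 3\pmod 5,\end{cases}$$ where $\mathcal{A}_{5,k}=\{a\cdot 5^b: a\in\mathcal{A}_k,\ b\ge 1\}$ and $\mathcal{B}_{5,k}=\{a\cdot 5^b: a\in\mathcal{B}_k,\ b\ge 1\}$. Moreover (still with $k\equiv 1\pmod 3$), if $k\equiv 1$ or $3\pmod 5$, $k\not\equiv 6,18\pmod{25}$ and $k>1$, then $\mathcal{D}_k(n)=\min\mathcal{S}_{k,n}$ whenever $n\ge n_p(5/3)$ for some odd prime divisor $p$ of $k(k+1)$. If $k>1$ is odd and $p$ divides $k$, it suffices to require $n\ge n_p^{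o}(5/3)$.
   Context: For an integer $k\ge 1$ let $U_0(k)=0$, $U_1(k)=1$, $U_{n+2}(k)=(4k+2)U_{n+1}(k)-U_n(k)$ for $n\ge 0$. For fixed $k$ these integers are pairwise distinct. The discriminator $\mathcal{D}_k(n)$ ($n\ge 1$) is the smallest integer $m\ge 1$ such that $U_0(k),\ldots,U_{n-1}(k)$ are pairwise incongruent modulo $m$. The sets $\mathcal{A}_k,\mathcal{B}_k$ of positive integers ($p$ denotes primes): $\mathcal{A}_k=\{m \text{ odd}: p\mid m\Rightarrow p\mid k\}$ if $k\not\equiv 6\pmod 9$, and $\mathcal{A}_k=\{m\text{ odd},\ 9\nmid m: p\mid m\Rightarrow p\mid k\}$ if $k\equiv 6\pmod 9$; $\mathcal{B}_k=\{m\text{ even}: p\mid m\Rightarrow p\mid k(k+1)\}$ if $k\not\equiv 6\pmod 9$ and $k\not\equiv 2\pmod 9$, and $\mathcal{B}_k=\{m\text{ even},\ 9\nmid m: p\mid m\Rightarrow p\mid k(k+1)\}$ if $k\equiv 6\pmod 9$ or $k\equiv 2\pmod 9$. For a real number $\alpha>1$ and a prime $p\ge 3$, $n_p(\alpha)$ is the smallest positive integer $m$ such that for every integer $n\ge m$ the interval $[n,n\alpha)$ contains an even integer of the form $2^a p^b$ (with integers $a,b\ge 0$). The number $n_p^{o}(\alpha)$ is defined in the same way but without the requirement that the integer $2^ap^b$ be even. *)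

theory Defs
  imports Complex_Main "HOL-Number_Theory.Number_Theory"
begin

fun U :: "nat \<Rightarrow> nat \<Rightarrow> int" where
  "U k 0 = 0"
| "U k (Suc 0) = 1"
| "U k (Suc (Suc n)) = (4 * int k + 2) * U k (Suc n) - U k n"

definition discriminator :: "nat \<Rightarrow> nat \<Rightarrow> nat" where
  "discriminator k n =
     (LEAST m. m \<ge> 1 \<and> (\<forall>i<n. \<forall>j<n. i \<noteq> j \<longrightarrow> \<not> [U k i = U k j] (mod int m)))"

definition setA :: "nat \<Rightarrow> nat set" where
  "setA k =
     (if [k = 6] (mod 9)
      then {m. m \<ge> 1 \<and> odd m \<and> \<not> 9 dvd m \<and> (\<forall>p. prime p \<longrightarrow> p dvd m \<longrightarrow> p dvd k)}
      else {m. m \<ge> 1 \<and> odd m \<and> (\<forall>p. prime p \<longrightarrow> p dvd m \<longrightarrow> p dvd k)})"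

definition setB :: "nat \<Rightarrow> nat set" where
  "setB k =
     (if [k = 6] (mod 9) \<or> [k = 2] (mod 9)
      then {m. m \<ge> 1 \<and> even m \<and> \<not> 9 dvd m \<and> (\<forall>p. prime p \<longrightarrow> p dvd m \<longrightarrow> p dvd k * (k + 1))}
      else {m. m \<ge> 1 \<and> even m \<and> (\<forall>p. prime p \<longrightarrow> p dvd m \<longrightarrow> p dvd k * (k + 1))})"

definition setA5 :: "nat \<Rightarrow> nat set" where
  "setA5 k = {a * 5 ^ b | a b. a \<in> setA k \<and> b \<ge> 1}"

definition setB5 :: "nat \<Rightarrow> nat set" where
  "setB5 k = {a * 5 ^ b | a b. a \<in> setB k \<and> b \<ge> 1}"

definition setS :: "nat \<Rightarrow> nat \<Rightarrow> nat set" where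
  "setS k n = {m \<in> setA k \<union> setB k. m \<ge> n}"

definition n_even :: "nat \<Rightarrow> real \<Rightarrow> nat" where
  "n_even p \<alpha> =
     (LEAST m. m \<ge> 1 \<and>
        (\<forall>n\<ge>m. \<exists>a b. even (2 ^ a * p ^ b) \<and> real (2 ^ a * p ^ b) \<in> {real n..<real n * \<alpha>}))"

definition n_any :: "nat \<Rightarrow> real \<Rightarrow> nat" where
  "n_any p \<alpha> =
     (LEAST m. m \<ge> 1 \<and>
        (\<forall>n\<ge>m. \<exists>a b. real (2 ^ a * p ^ b) \<in> {real n..<real n * \<alpha>}))"

end

theory Submission
  imports Defs
begin

text \<open>Put \<open>w = 2k + 1\<close>, \<open>D = w\<^sup>2 - 1 = 4k(k+1)\<close> and \<open>T\<^sub>n = U\<^sub>n\<^sub>+\<^sub>1 - w U\<^sub>n\<close>. Then \<open>T\<^sub>n + U\<^sub>n \<surd>D\<close> is the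
\<open>n\<close>-th power of the unit \<open>w + \<surd>D\<close> of norm 1, and everything below is read off from the addition
formulas of this pair and from \<open>T\<^sub>n\<^sup>2 - D U\<^sub>n\<^sup>2 = 1\<close>.

The primes that divide \<open>D\<close> are those of \<open>k(k+1)\<close>. For such a prime, \<open>U\<^sub>n\<close> behaves like \<open>n\<close> times a unit:
its powers divide \<open>U\<^sub>n\<close> exactly when they divide \<open>n\<close>, apart from a defect of 3 when \<open>9\<close> divides \<open>U\<^sub>3\<close>, that
is, when \<open>k\<close> is 2 or 6 modulo 9. Differences factor as \<open>U\<^sub>r\<^sub>+\<^sub>s - U\<^sub>r\<^sub>-\<^sub>s = 2 U\<^sub>s T\<^sub>r\<close>, so a congruence between
two terms becomes a divisibility between indices, and every modulus \<open>m\<close> in \<open>\<A>\<^sub>k \<union> \<B>\<^sub>k\<close> separates the first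
\<open>m\<close> terms. If 5 has rank of appearance 3 and \<open>25\<close> does not divide \<open>U\<^sub>3\<close>, multiplying by a power of 5 still
leaves the first \<open>3m/5\<close> terms distinct (lemma \<open>discriminates_times_5_power\<close>).

Conversely let \<open>m\<close> separate the first \<open>n\<close> terms. Then \<open>n\<close> is at most the index of any positive-index term
divisible by \<open>m\<close>. As the powers of 2 belong to the family, only \<open>m\<close> with \<open>2n > m + 1\<close> matter. For odd \<open>m\<close>
composed of primes of \<open>k(k+1)\<close>, one of them dividing \<open>k + 1\<close>, the sequence has a reflection in addition
to its period, and the two produce an early collision (lemma \<open>collision\<close>). A prime \<open>p\<close> outside \<open>D\<close> has rank at most \<open>(p+1)/2\<close>, by Frobenius and
because \<open>w + \<surd>D\<close> has norm 1; hence two such primes are excluded at once, and one such prime costs a factor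
\<open>(p+1)/(2p)\<close>. If 3 divides \<open>k(k+1)\<close>, then \<open>p\<close> is at least 5 and the numbers \<open>2\<^sup>e\<close> and \<open>3\<cdot>2\<^sup>e\<close> are dense enough to win.
Otherwise write \<open>m = p\<^sup>b\<^sup>+\<^sup>1 y\<close> and compare with the multiples of \<open>y\<close>: for \<open>b = 0\<close> a power of 2 times \<open>y\<close> is
good enough, for \<open>p \<equiv> 3 (mod 4)\<close> the bound \<open>(p+1)/2\<close> is even and parity or a reflection improves it enough, for
\<open>p = 5\<close> one finds exactly the exceptional moduli of the theorem, and for the remaining \<open>p \<ge> 13\<close> some number
\<open>y 2\<^sup>a\<close> or \<open>y 2\<^sup>a 5\<^sup>f\<close> lies below \<open>m\<close> and separates \<open>n\<close> terms as well (lemma \<open>power_of_5_between\<close>).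

The last part of the theorem needs an element of \<open>\<A>\<^sub>k \<union> \<B>\<^sub>k\<close> below \<open>5n/3\<close>. That is what the thresholds
\<open>n\<^sub>p(5/3)\<close> provide, once it is known that they exist (lemma \<open>two_p_smooth_in_interval\<close>).\<close>

section \<open>The Pell pair and its addition formulas\<close>

definition half_trace :: "nat \<Rightarrow> int" where "half_trace k = 2 * int k + 1"

definition pell_D :: "nat \<Rightarrow> int" where "pell_D k = 4 * int k * (int k + 1)"

text \<open>This is the Chebyshev value \<open>T\<^sub>n(w)\<close> at \<open>w = 2k + 1\<close>, the companion of \<open>U\<^sub>n\<close> in the powers
\<open>(w + \<surd>D)\<^sup>n = T\<^sub>n + U\<^sub>n \<surd>D\<close>.\<close>
definition T :: "nat \<Rightarrow> nat \<Rightarrow> int" where "T k n = U k (Suc n) - half_trace k * U k n"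

lemma pell_D_half_trace: "pell_D k = half_trace k ^ 2 - 1"
  by (simp add: pell_D_def half_trace_def power2_eq_square algebra_simps)

lemma T_0 [simp]: "T k 0 = 1" and T_1 [simp]: "T k (Suc 0) = half_trace k"
  by (simp_all add: T_def half_trace_def)

lemma U_Suc: "U k (Suc n) = half_trace k * U k n + T k n"
  by (simp add: T_def)

lemma T_Suc: "T k (Suc n) = half_trace k * T k n + pell_D k * U k n"
proof -
  have "T k (Suc n) = half_trace k * U k (Suc n) - U k n"
    by (simp add: T_def half_trace_def algebra_simps)
  then show ?thesis
    by (simp add: U_Suc pell_D_half_trace power2_eq_square algebra_simps)
qed

declare U.simps(3) [simp del]

lemma add_formulas:
  "U k (m + n) = U k m * T k n + T k m * U k n \<and>
   T k (m + n) = T k m * T k n + pell_D k * U k m * U k n"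
  by (induction n) (simp_all add: U_Suc T_Suc algebra_simps)

lemmas U_add = add_formulas [THEN conjunct1]
lemmas T_add = add_formulas [THEN conjunct2]

lemma pell: "T k n ^ 2 = 1 + pell_D k * U k n ^ 2"
proof (induction n)
  case (Suc n)
  have "T k (Suc n) ^ 2 - pell_D k * U k (Suc n) ^ 2
      = (half_trace k ^ 2 - pell_D k) * (T k n ^ 2 - pell_D k * U k n ^ 2)"
    unfolding U_Suc T_Suc by (simp add: power2_eq_square) (simp add: algebra_simps)
  also have "\<dots> = 1" unfolding Suc by (simp add: pell_D_half_trace)
  finally show ?case by simp
qed simp

lemma pell_factor: "(T k n - 1) * (T k n + 1) = pell_D k * U k n ^ 2"
proof -
  have "(T k n - 1) * (T k n + 1) = T k n ^ 2 - 1" by (simp add: power2_eq_square ring_distribs)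
  then show ?thesis by (simp add: pell)
qed

lemma T_double: "T k (2 * n) = 2 * T k n ^ 2 - 1"
proof -
  have "T k (2 * n) = T k n ^ 2 + pell_D k * U k n ^ 2"
    unfolding mult_2 T_add by (simp add: power2_eq_square)
  then show ?thesis by (simp add: pell)
qed

lemma U_double: "U k (2 * n) = 2 * U k n * T k n"
  unfolding mult_2 U_add by simp

lemma U_diff:
  assumes "j \<le> n" shows "U k (n - j) = U k n * T k j - T k n * U k j"
proof -
  obtain d where n: "n = j + d" using assms le_Suc_ex by blast
  have "U k (j + d) * T k j - T k (j + d) * U k j = U k d * (T k j ^ 2 - pell_D k * U k j ^ 2)"
    unfolding U_add T_add by (simp add: power2_eq_square) (simp add: algebra_simps)
  then show ?thesis by (simp add: n pell)
qed

lemma U_symm_diff: "s \<le> r \<Longrightarrow> U k (r + s) - U k (r - s) = 2 * U k s * T k r"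
  by (simp add: U_add U_diff algebra_simps)

section \<open>Divisibility of terms at multiples of an index\<close>

text \<open>Expand \<open>(T\<^sub>t + U\<^sub>t \<surd>D)\<^sup>n\<close> and stop after the leading term of each component. For \<open>t = 1\<close> this is an expansion modulo \<open>D\<close>,
for general \<open>t\<close> one modulo \<open>U\<^sub>t\<^sup>2\<close> (modulo \<open>U\<^sub>t\<^sup>3\<close> in the case of \<open>U\<close>); both uses recur below.\<close>
lemma multiple_index:
  "\<exists>y z. U k (n * t) = U k t * (int n * T k t ^ (n - 1) + pell_D k * U k t ^ 2 * y) \<and>
         T k (n * t) = T k t ^ n + pell_D k * U k t ^ 2 * z"
proof (induction n)
  case (Suc n)
  then obtain y z where
    y: "U k (n * t) = U k t * (int n * T k t ^ (n - 1) + pell_D k * U k t ^ 2 * y)" and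
    z: "T k (n * t) = T k t ^ n + pell_D k * U k t ^ 2 * z" by blast
  have n: "T k t * (int n * T k t ^ (n - 1)) = int n * T k t ^ n"
    by (cases n) simp_all
  have U: "U k (Suc n * t) = U k t * (T k t * (int n * T k t ^ (n - 1)) + T k t ^ n
      + pell_D k * U k t ^ 2 * (T k t * y + z))"
    using U_add [of k t "n * t"] by (simp add: y z algebra_simps)
  have T: "T k (Suc n * t) = T k t ^ Suc n + pell_D k * U k t ^ 2 *
      (T k t * z + (int n * T k t ^ (n - 1) + pell_D k * U k t ^ 2 * y))"
    using T_add [of k t "n * t"] by (simp add: y z power2_eq_square algebra_simps)
  show ?case
    unfolding U T n
    by (rule exI [of _ "T k t * y + z"],
        rule exI [of _ "T k t * z + (int n * T k t ^ (n - 1) + pell_D k * U k t ^ 2 * y)"])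
      (simp add: algebra_simps)
qed (rule exI [of _ 0], rule exI [of _ 0], simp)

lemma U_dvd_mult: "U k t dvd U k (n * t)"
  using multiple_index [of k n t] by auto

lemma dvd_U_mult: "d dvd U k t \<Longrightarrow> d dvd U k (n * t)" "d dvd U k t \<Longrightarrow> d dvd U k (t * n)"
  using U_dvd_mult [of k t n] by (auto simp: mult.commute intro: dvd_trans)

lemma T_mult_cong: "d dvd U k t \<Longrightarrow> [T k (n * t) = T k t ^ n] (mod d)"
  using multiple_index [of k n t] 
  by (auto simp: cong_iff_dvd_diff power2_eq_square)

lemma first_order_mod_pell_D:
  "[half_trace k * U k n = int n * half_trace k ^ n] (mod pell_D k)"
  "[T k n = half_trace k ^ n] (mod pell_D k)"
proof -
  obtain y z where "U k n = int n * half_trace k ^ (n - 1) + pell_D k * y"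
    "T k n = half_trace k ^ n + pell_D k * z"
    using multiple_index [of k n 1] by auto
  moreover have "half_trace k * (int n * half_trace k ^ (n - 1)) = int n * half_trace k ^ n"
    by (cases n) auto
  ultimately show "[half_trace k * U k n = int n * half_trace k ^ n] (mod pell_D k)"
  "[T k n = half_trace k ^ n] (mod pell_D k)"
    by (auto simp: cong_iff_dvd_diff algebra_simps)
qed

lemma coprime_T:
  assumes "d dvd pell_D k \<or> d dvd U k n" shows "coprime d (T k n)"
proof (rule coprimeI)
  fix c assume c: "c dvd d" "c dvd T k n"
  then have "c dvd pell_D k * U k n ^ 2"
    using assms by (auto simp: power2_eq_square intro: dvd_trans)
  moreover have "c dvd T k n ^ 2" using c by (simp add: power2_eq_square)
  ultimately have "c dvd T k n ^ 2 - pell_D k * U k n ^ 2" by (rule dvd_diff [rotated])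
  then show "is_unit c" by (simp add: pell)
qed

lemma coprime_half_trace: "d dvd pell_D k \<Longrightarrow> coprime d (half_trace k)"
  using coprime_T [of d k 1] by simp

lemma prime_dvd_U_iff:
  assumes "prime p" "int p dvd pell_D k"
  shows "int p dvd U k n \<longleftrightarrow> p dvd n"
proof -
  have c: "coprime (int p) (half_trace k)" using assms coprime_half_trace by blast
  have "int p dvd U k n \<longleftrightarrow> int p dvd half_trace k * U k n"
    using c by (simp add: coprime_dvd_mult_right_iff)
  also have "\<dots> \<longleftrightarrow> int p dvd int n * half_trace k ^ n"
    using first_order_mod_pell_D(1) assms(2) by (meson cong_dvd_iff cong_dvd_modulus)
  also have "\<dots> \<longleftrightarrow> p dvd n"
    using c by (simp add: coprime_dvd_mult_left_iff)
  finally show ?thesis .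
qed

text \<open>When \<open>p\<close> divides \<open>U\<^sub>t\<close>, both summands of the cofactor of \<open>U\<^sub>t\<close> in \<open>U\<^sub>p\<^sub>t\<close> are divisible by \<open>p\<close>, so each
multiplication of the index by \<open>p\<close> gains at least one factor \<open>p\<close>.\<close>
lemma prime_power_lift:
  assumes "int p ^ Suc b dvd U k t"
  shows "int p ^ Suc (b + c) dvd U k (p ^ c * t)"
proof (induction c)
  case (Suc c)
  define t' where "t' = p ^ c * t"
  obtain y where y: "U k (p * t') = U k t' * (int p * T k t' ^ (p - 1) + pell_D k * U k t' ^ 2 * y)"
    using multiple_index [of k p t'] by blast
  have *: "int p ^ Suc (b + c) dvd U k t'" using Suc by (simp add: t'_def)
  then have "int p dvd U k t'" by (metis dvd_mult_left power_Suc)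
  then have "int p dvd int p * T k t' ^ (p - 1) + pell_D k * U k t' ^ 2 * y"
    by (simp add: power2_eq_square)
  with * have "int p ^ Suc (b + c) * int p dvd U k (p * t')" unfolding y by (rule mult_dvd_mono)
  then show ?case by (simp add: t'_def mult_ac)
qed (use assms in simp)

lemma prime_power_dvd_U:
  assumes "prime p" "int p dvd pell_D k"
  shows "int (p ^ b) dvd U k (p ^ b)"
proof (cases b)
  case (Suc c)
  have "int p ^ Suc 0 dvd U k p" using assms by (simp add: prime_dvd_U_iff)
  from prime_power_lift [OF this, of c] show ?thesis by (simp add: Suc mult_ac)
qed simp

lemma prime_power_divisors_imp_dvd:
  fixes a x :: nat
  assumes "a > 0" "\<And>p c. prime p \<Longrightarrow> p ^ Suc c dvd a \<Longrightarrow> p ^ Suc c dvd x"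
  shows "a dvd x"
proof (cases "x = 0")
  case False
  show ?thesis
  proof (rule multiplicity_le_imp_dvd)
    fix p :: nat assume p: "prime p"
    show "multiplicity p a \<le> multiplicity p x"
    proof (cases "multiplicity p a")
      case (Suc c)
      then have "p ^ Suc c dvd a" by (metis multiplicity_dvd)
      then show ?thesis using assms(2) [OF p] False p Suc
        by (metis multiplicity_geI not_prime_unit prime_imp_prime_elem)
    qed simp
  qed (use assms in simp)
qed simp

lemma dvd_U_self:
  assumes "m > 0" "\<And>p. prime p \<Longrightarrow> p dvd m \<Longrightarrow> int p dvd pell_D k"
  shows "int m dvd U k m"
proof -
  have "m dvd nat \<bar>U k m\<bar>"
  proof (rule prime_power_divisors_imp_dvd)
    fix p c assume p: "prime p" "p ^ Suc c dvd m"
    then have "p dvd m" by (metis dvd_mult_left power_Suc)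
    with p assms have "int (p ^ Suc c) dvd U k (p ^ Suc c)" by (intro prime_power_dvd_U) auto
    moreover obtain q where "m = p ^ Suc c * q" using p(2) by blast
    ultimately have "int (p ^ Suc c) dvd U k m" using dvd_U_mult(2) by blast
    then show "p ^ Suc c dvd nat \<bar>U k m\<bar>" using int_dvd_int_iff by fastforce
  qed (use assms in simp)
  then show ?thesis by auto
qed

text \<open>The gain is exactly one factor \<open>p\<close>: modulo \<open>p\<^sup>c\<^sup>+\<^sup>3\<close> the term \<open>U\<^sub>n\<^sub>t\<close> is \<open>n T\<^sub>t\<^sup>n\<^sup>-\<^sup>1 U\<^sub>t\<close>, and \<open>T\<^sub>t\<close> is prime to \<open>p\<close>.
This includes \<open>p = 2\<close> because the error term is cubic in \<open>U\<^sub>t\<close>.\<close>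
lemma exact_lift:
  assumes "prime p" "int p ^ Suc c dvd U k t" "\<not> int p ^ Suc (Suc c) dvd U k t"
    and "int p ^ (Suc c + d) dvd U k (n * t)"
  shows "p ^ d dvd n"
  using assms(2-)
proof (induction d arbitrary: c t n)
  case (Suc d)
  have step: "\<exists>y. U k (n * t) = U k t * (int n * T k t ^ (n - 1)) + int p ^ Suc (Suc (Suc c)) * y" for n
  proof -
    obtain y where y: "U k (n * t) = U k t * (int n * T k t ^ (n - 1) + pell_D k * U k t ^ 2 * y)"
      using multiple_index [of k n t] by blast
    have "int p dvd U k t" using Suc.prems(1) by (metis dvd_mult_left power_Suc)
    then have "int p ^ Suc c * (int p * int p) dvd U k t * (U k t * U k t)"
      using Suc.prems(1) by (intro mult_dvd_mono)
    then obtain x where "U k t * (U k t * U k t) = int p ^ Suc c * (int p * int p) * x" by blast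
    then have "U k (n * t) = U k t * (int n * T k t ^ (n - 1)) + int p ^ Suc (Suc (Suc c)) * (x * pell_D k * y)"
      unfolding y by (simp add: power2_eq_square algebra_simps)
    then show ?thesis by blast
  qed
  have pU: "int p dvd U k t" using Suc.prems(1) by (metis dvd_mult_left power_Suc)
  have cop: "coprime (int p) (T k t ^ j)" for j
    using pU coprime_T [of "int p" k t] by simp
  have nz: "int p \<noteq> 0" using assms(1) by auto
  obtain u where u: "U k t = int p ^ Suc c * u" "\<not> int p dvd u"
  proof -
    obtain u where u: "U k t = int p ^ Suc c * u" using Suc.prems(1) by blast
    moreover have "\<not> int p dvd u"
    proof
      assume "int p dvd u"
      then have "int p ^ Suc c * int p dvd U k t" unfolding u by (rule mult_dvd_mono [OF dvd_refl])
      then show False using Suc.prems(2) by (simp add: mult.commute)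
    qed
    ultimately show ?thesis using that by blast
  qed
  have "p dvd n"
  proof -
    obtain y where y: "U k (n * t) = U k t * (int n * T k t ^ (n - 1)) + int p ^ Suc (Suc (Suc c)) * y"
      using step by blast
    have "int p ^ Suc c * int p dvd U k (n * t)"
      using Suc.prems(3) by (rule dvd_trans [rotated]) (simp add: power_add flip: power_Suc2)
    then have "int p ^ Suc c * int p dvd int p ^ Suc c * (u * int n * T k t ^ (n - 1) + int p * (int p * y))"
      unfolding y u by (simp add: algebra_simps)
    then have "int p dvd u * int n * T k t ^ (n - 1)"
      using nz by (simp add: dvd_add_left_iff)
    then have "int p dvd int n"
      using cop [of "n - 1"] u(2) assms(1)
      by (metis coprime_dvd_mult_left_iff prime_dvd_mult_iff prime_nat_int_transfer)
    then show ?thesis by simp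
  qed
  then obtain n' where n': "n = n' * p" by (metis dvdE mult.commute)
  obtain y where y: "U k (p * t) = U k t * (int p * T k t ^ (p - 1)) + int p ^ Suc (Suc (Suc c)) * y"
    using step by blast
  have y': "U k (p * t) = int p ^ Suc (Suc c) * (u * T k t ^ (p - 1) + int p * y)"
    unfolding y u by (simp add: algebra_simps)
  have "p ^ d dvd n'"
  proof (rule Suc.IH)
    show "int p ^ Suc (Suc c) dvd U k (p * t)" unfolding y' by simp
    show "\<not> int p ^ Suc (Suc (Suc c)) dvd U k (p * t)"
    proof
      assume "int p ^ Suc (Suc (Suc c)) dvd U k (p * t)"
      then have "int p ^ Suc (Suc c) * int p dvd int p ^ Suc (Suc c) * (u * T k t ^ (p - 1) + int p * y)"
        unfolding y' by (simp only: power_Suc2)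
      then have "int p dvd u * T k t ^ (p - 1)" using nz by (simp add: dvd_add_left_iff)
      then show False using u(2) coprime_dvd_mult_left_iff [OF cop] by blast
    qed
    show "int p ^ (Suc (Suc c) + d) dvd U k (n' * (p * t))"
      using Suc.prems(3) by (simp add: n' mult_ac)
  qed
  then show ?case by (simp add: n')
qed simp

section \<open>The rank of appearance of a prime\<close>

text \<open>Pascal's rule for the linear functional that sends \<open>X\<^sup>j\<close> to \<open>f j\<close>, applied to \<open>(w + X)\<^sup>n\<^sup>+\<^sup>1\<close>. It gives the
binomial expansion of \<open>(w + \<surd>D)\<^sup>n\<close> without leaving the integers.\<close>
lemma binomial_transform_Suc:
  fixes w :: int
  shows "(\<Sum>j\<le>Suc n. int (Suc n choose j) * w ^ (Suc n - j) * f j)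
    = w * (\<Sum>j\<le>n. int (n choose j) * w ^ (n - j) * f j)
      + (\<Sum>j\<le>n. int (n choose j) * w ^ (n - j) * f (Suc j))"
proof -
  have "w * (\<Sum>j\<le>n. int (n choose j) * w ^ (n - j) * f j)
      = (\<Sum>j\<le>n. int (n choose j) * w ^ (Suc n - j) * f j)"
    unfolding sum_distrib_left by (rule sum.cong) (auto simp: Suc_diff_le)
  also have "\<dots> = (\<Sum>j\<le>Suc n. int (n choose j) * w ^ (Suc n - j) * f j)" by simp
  also have "\<dots> = w ^ Suc n * f 0 + (\<Sum>j\<le>n. int (n choose Suc j) * w ^ (n - j) * f (Suc j))"
    by (subst sum.atMost_Suc_shift) simp
  finally have 1: "w * (\<Sum>j\<le>n. int (n choose j) * w ^ (n - j) * f j) = \<dots>" .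
  have "(\<Sum>j\<le>Suc n. int (Suc n choose j) * w ^ (Suc n - j) * f j)
      = w ^ Suc n * f 0 + (\<Sum>j\<le>n. int (Suc n choose Suc j) * w ^ (n - j) * f (Suc j))"
    by (subst sum.atMost_Suc_shift) simp
  also have "(\<Sum>j\<le>n. int (Suc n choose Suc j) * w ^ (n - j) * f (Suc j))
     = (\<Sum>j\<le>n. int (n choose Suc j) * w ^ (n - j) * f (Suc j))
      + (\<Sum>j\<le>n. int (n choose j) * w ^ (n - j) * f (Suc j))"
    by (simp add: sum.distrib algebra_simps flip: sum.distrib)
  finally show ?thesis unfolding 1 by simp
qed

lemma T_U_binomial:
  "T k n = (\<Sum>j\<le>n. int (n choose j) * half_trace k ^ (n - j) * (if even j then pell_D k ^ (j div 2) else 0)) \<and>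
   U k n = (\<Sum>j\<le>n. int (n choose j) * half_trace k ^ (n - j) * (if odd j then pell_D k ^ (j div 2) else 0))"
proof (induction n)
  case (Suc n)
  have s: "(if even (Suc j) then pell_D k ^ (Suc j div 2) else 0)
      = pell_D k * (if odd j then pell_D k ^ (j div 2) else 0)" for j by (auto elim!: oddE)
  have s': "(if odd (Suc j) then pell_D k ^ (Suc j div 2) else 0)
      = (if even j then pell_D k ^ (j div 2) else 0)" for j by (auto elim!: evenE)
  have d: "(\<Sum>j\<le>n. int (n choose j) * half_trace k ^ (n - j) * (pell_D k * g j))
     = pell_D k * (\<Sum>j\<le>n. int (n choose j) * half_trace k ^ (n - j) * g j)" for g
    by (simp add: sum_distrib_left mult_ac)
  show ?case
    unfolding binomial_transform_Suc s s' d unfolding T_Suc U_Suc 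
    by (simp only: Suc [THEN conjunct1, symmetric] Suc [THEN conjunct2, symmetric])
qed auto

lemma binomial_transform_prime:
  fixes w :: int
  assumes "prime p"
  shows "[(\<Sum>j\<le>p. int (p choose j) * w ^ (p - j) * f j) = w ^ p * f 0 + f p] (mod int p)"
proof -
  have p: "p > 0" using assms by (simp add: prime_gt_0_nat)
  then have "{..p} = insert 0 (insert p {1..<p})" by auto
  then have "(\<Sum>j\<le>p. int (p choose j) * w ^ (p - j) * f j)
    = (w ^ p * f 0 + f p) + (\<Sum>j\<in>{1..<p}. int (p choose j) * w ^ (p - j) * f j)"
    using p by simp
  moreover have "int p dvd (\<Sum>j\<in>{1..<p}. int (p choose j) * w ^ (p - j) * f j)"
    using dvd_choose_prime [of _ p] assms by (intro dvd_sum dvd_mult2) auto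
  ultimately show ?thesis by (simp add: cong_iff_dvd_diff)
qed


text \<open>Frobenius: \<open>(w + \<surd>D)\<^sup>p \<equiv> w + D\<^sup>(\<^sup>p\<^sup>-\<^sup>1\<^sup>)\<^sup>/\<^sup>2 \<surd>D\<close> modulo \<open>p\<close>.\<close>
lemma prime_index:
  assumes "prime p" "odd p"
  shows "[U k p = pell_D k ^ ((p - 1) div 2)] (mod int p)" "[T k p = half_trace k] (mod int p)"
proof -
  have d: "p div 2 = (p - 1) div 2" using assms(2) by (auto elim!: oddE)
  show "[U k p = pell_D k ^ ((p - 1) div 2)] (mod int p)"
    using binomial_transform_prime [OF assms(1), of "half_trace k"
       "\<lambda>j. if odd j then pell_D k ^ (j div 2) else 0"] assms(2)
    unfolding T_U_binomial [THEN conjunct2, symmetric] d by simp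
  have "[T k p = half_trace k ^ p] (mod int p)"
    using binomial_transform_prime [OF assms(1), of "half_trace k"
       "\<lambda>j. if even j then pell_D k ^ (j div 2) else 0"] assms(2)
    unfolding T_U_binomial [THEN conjunct1, symmetric] by simp
  moreover have "[half_trace k ^ p = half_trace k] (mod int p)"
  proof -
    have "[int ((2 * k + 1) ^ p) = int (2 * k + 1)] (mod int p)"
    proof (cases "p dvd 2 * k + 1")
      case True
      then show ?thesis unfolding cong_int_iff using assms
        by (metis cong_0_iff cong_sym cong_trans dvd_power prime_gt_0_nat dvd_trans)
    next
      case False
      have "[(2 * k + 1) ^ (p - 1) * (2 * k + 1) = 1 * (2 * k + 1)] (mod p)"
        using fermat_theorem [OF assms(1) False] cong_scalar_right by blast
      then show ?thesis unfolding cong_int_iff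
        using assms(1) prime_gt_0_nat [of p] by (cases p) (auto simp: mult_ac)
    qed
    then show ?thesis by (simp add: half_trace_def add.commute)
  qed
  ultimately show "[T k p = half_trace k] (mod int p)" by (rule cong_trans)
qed

text \<open>With \<open>e = D\<^sup>(\<^sup>p\<^sup>-\<^sup>1\<^sup>)\<^sup>/\<^sup>2 \<equiv> \<plusminus>1\<close>, Frobenius gives \<open>(w + \<surd>D)\<^sup>p\<^sup>-\<^sup>e \<equiv> 1\<close>, because the conjugate of \<open>w + \<surd>D\<close> is its
inverse. The duplication formula \<open>T\<^sub>2\<^sub>h - 1 = 2 D U\<^sub>h\<^sup>2\<close> then halves the index \<open>p - e\<close>, and this factor 2 is what
makes the whole comparison with powers of 2 possible.\<close>
lemma rank_of_prime:
  assumes p: "prime p" "odd p" and D: "\<not> int p dvd pell_D k"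
  shows "\<exists>h. int p dvd U k h \<and> (2 * h = p - 1 \<or> 2 * h = p + 1)"
proof -
  define e where "e = pell_D k ^ ((p - 1) div 2)"
  have p3: "p \<ge> 3" using p by (cases "p = 2") (use prime_ge_2_nat [OF p(1)] in auto)
  have ipp: "prime (int p)" using p by simp
  have "pell_D k = int (4 * k * (k + 1))" by (simp add: pell_D_def algebra_simps)
  then have "[pell_D k ^ (p - 1) = 1] (mod int p)"
    using fermat_theorem [of p "4 * k * (k + 1)"] p(1) D
    by (metis cong_int_iff int_dvd_int_iff of_nat_1 of_nat_power)
  moreover have "pell_D k ^ (p - 1) = e ^ 2"
    using p(2) by (auto simp: e_def elim!: oddE simp flip: power_mult)
  ultimately have "int p dvd (e - 1) * (e + 1)"
    by (simp add: cong_iff_dvd_diff power2_eq_square algebra_simps)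
  then have e: "int p dvd e - 1 \<or> int p dvd e + 1" using ipp prime_dvd_mult_iff by blast
  obtain x where x: "U k p = e + int p * x"
    using prime_index(1) [OF p, of k] unfolding e_def by (metis cong_iff_lin cong_sym)
  obtain y where y: "T k p = half_trace k + int p * y"
    using prime_index(2) [OF p, of k] by (metis cong_iff_lin cong_sym)
  have half: "int p dvd U k h" if "int p dvd T k (2 * h) - 1" for h
  proof -
    have "int p dvd 2 * (pell_D k * U k h ^ 2)" using that by (simp add: T_double pell)
    moreover have "\<not> int p dvd 2" using p3 zdvd_imp_le by fastforce
    ultimately show ?thesis using D ipp by (simp add: prime_dvd_mult_iff prime_dvd_power_iff)
  qed
  from e show ?thesis
  proof
    assume "int p dvd e - 1"
    then obtain z where "e - 1 = int p * z" by (rule dvdE)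
    then have z: "e = 1 + int p * z" by simp
    have "T k p * half_trace k - pell_D k * U k p = T k (p - 1)"
    proof -
      obtain q where q: "p = Suc q" using p3 by (cases p) auto
      have "(w * t + d * u) * w - d * (w * u + t) = (w ^ 2 - d) * t" for w t d u :: int
        by (simp add: power2_eq_square algebra_simps)
      then show ?thesis unfolding q U_Suc T_Suc by (simp add: pell_D_half_trace)
    qed
    moreover have "(w + P * y) * w - d * (1 + P * z + P * x) - 1 = P * (y * w - d * x - d * z)"
      if "d = w ^ 2 - 1" for P w d :: int
      using that by (simp add: power2_eq_square algebra_simps)
    ultimately have "T k (p - 1) - 1 = int p * (y * half_trace k - pell_D k * x - pell_D k * z)"
      using pell_D_half_trace [of k] by (metis x y z)
    moreover obtain h where "p - 1 = 2 * h" using p(2) by (metis oddE add_diff_cancel_right')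
    ultimately show ?thesis using half by (metis dvd_triv_left)
  next
    assume "int p dvd e + 1"
    then obtain z where "e + 1 = int p * z" by (rule dvdE)
    then have z: "e = - 1 + int p * z" by simp
    have "T k (p + 1) = half_trace k * T k p + pell_D k * U k p" by (simp add: T_Suc)
    moreover have "w * (w + P * y) + d * (- 1 + P * z + P * x) - 1 = P * (y * w + d * x + d * z)"
      if "d = w ^ 2 - 1" for P w d :: int
      using that by (simp add: power2_eq_square algebra_simps)
    ultimately have "T k (p + 1) - 1 = int p * (y * half_trace k + pell_D k * x + pell_D k * z)"
      using pell_D_half_trace [of k] by (metis x y z)
    moreover obtain h where "p + 1 = 2 * h" using p(2) by (metis evenE odd_even_add odd_one)
    ultimately show ?thesis using half by (metis dvd_triv_left)
  qed
qed

section \<open>Indices divisible by the modulus\<close>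

text \<open>One more term of the expansion modulo \<open>D\<close>. The powers of \<open>w\<close> on the left avoid truncated exponents;
they are harmless because \<open>w\<close> is a unit modulo \<open>D\<close>.\<close>
lemma second_order_mod_pell_D:
  "\<exists>y z. half_trace k ^ 3 * U k n = int n * half_trace k ^ (n + 2) + int (n choose 3) * half_trace k ^ n * pell_D k + pell_D k ^ 2 * y
     \<and> half_trace k ^ 2 * T k n = half_trace k ^ (n + 2) + int (n choose 2) * half_trace k ^ n * pell_D k + pell_D k ^ 2 * z"
proof (induction n)
  case (Suc n)
  then obtain y z where
    y: "half_trace k ^ 3 * U k n = int n * half_trace k ^ (n + 2) + int (n choose 3) * half_trace k ^ n * pell_D k + pell_D k ^ 2 * y" and
    z: "half_trace k ^ 2 * T k n = half_trace k ^ (n + 2) + int (n choose 2) * half_trace k ^ n * pell_D k + pell_D k ^ 2 * z"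
    by blast
  obtain x where x: "half_trace k * U k n = int n * half_trace k ^ n + pell_D k * x"
    using first_order_mod_pell_D(1) [of k n] by (metis cong_iff_lin cong_sym)
  have c: "Suc n choose 3 = (n choose 2) + (n choose 3)" "Suc n choose 2 = n + (n choose 2)"
    by (simp_all add: numeral_3_eq_3 numeral_2_eq_2)
  have "half_trace k ^ 3 * U k (Suc n) = half_trace k * (half_trace k ^ 3 * U k n) + half_trace k * (half_trace k ^ 2 * T k n)"
    by (simp add: U_Suc power3_eq_cube power2_eq_square algebra_simps)
  also have "\<dots> = int (Suc n) * half_trace k ^ (Suc n + 2) + int (Suc n choose 3) * half_trace k ^ Suc n * pell_D k + pell_D k ^ 2 * (half_trace k * (y + z))"
    unfolding y z c by (simp add: algebra_simps)
  finally have 1: "half_trace k ^ 3 * U k (Suc n) = \<dots>" .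
  have "half_trace k ^ 2 * T k (Suc n) = half_trace k * (half_trace k ^ 2 * T k n) + half_trace k * pell_D k * (half_trace k * U k n)"
    by (simp add: T_Suc power2_eq_square algebra_simps)
  also have "\<dots> = half_trace k ^ (Suc n + 2) + int (Suc n choose 2) * half_trace k ^ Suc n * pell_D k + pell_D k ^ 2 * (half_trace k * (z + x))"
    unfolding x z c by (simp add: algebra_simps power2_eq_square)
  finally have 2: "half_trace k ^ 2 * T k (Suc n) = \<dots>" .
  show ?case using 1 2 by blast
qed (auto simp: power2_eq_square numeral_2_eq_2 intro!: exI [of _ 0])

lemma U_2: "U k 2 = 2 * half_trace k"
  using U_double [of k 1] by simp

lemma U_3: "U k 3 = (4 * int k + 1) * (4 * int k + 3)"
  and T_3: "T k 3 = half_trace k * (4 * half_trace k ^ 2 - 3)"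
  by (simp_all add: numeral_3_eq_3 U_Suc T_Suc half_trace_def pell_D_def power2_eq_square algebra_simps)

text \<open>For \<open>p \<ge> 5\<close> the second-order coefficient \<open>p choose 3\<close> is divisible by \<open>p\<close>, so \<open>U\<^sub>p\<close> is \<open>p\<close> times a unit
modulo \<open>p\<^sup>2\<close>. For \<open>p = 3\<close> that coefficient is 1, and this is the origin of the exception modulo 9.\<close>
lemma not_prime_square_dvd_U:
  assumes p: "prime p" and D: "int p dvd pell_D k" and 3: "p = 3 \<longrightarrow> \<not> 9 dvd U k 3"
  shows "\<not> int p ^ 2 dvd U k p"
proof -
  consider "p = 2" | "p = 3" | "p \<ge> 5"
    using prime_ge_2_nat [OF p] p by (cases "p = 4") fastforce+
  then show ?thesis
  proof cases
    case 1
    then show ?thesis unfolding 1 U_2 half_trace_def by (simp add: U_2) presburger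
  next
    case 2
    then show ?thesis using 3 by (simp add: power2_eq_square)
  next
    case 3
    have cop: "coprime (int p) (half_trace k)" using coprime_half_trace D by blast
    show ?thesis
    proof
      assume a: "int p ^ 2 dvd U k p"
      obtain y where y: "half_trace k ^ 3 * U k p = int p * half_trace k ^ (p + 2) + int (p choose 3) * half_trace k ^ p * pell_D k + pell_D k ^ 2 * y"
        using second_order_mod_pell_D by blast
      have "p dvd p choose 3" using dvd_choose_prime [of 3 p] p 3 by simp
      then have "int p * int p dvd int (p choose 3) * (half_trace k ^ p * pell_D k)"
        using D by (intro mult_dvd_mono) auto
      moreover have "int p * int p dvd pell_D k ^ 2 * y"
        using D unfolding power2_eq_square by (intro dvd_mult2 mult_dvd_mono) auto
      moreover have "int p * int p dvd half_trace k ^ 3 * U k p" using a by (simp add: power2_eq_square)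
      ultimately have "int p * int p dvd int p * half_trace k ^ (p + 2)"
        unfolding y by (metis (no_types, lifting) dvd_add_left_iff mult.assoc)
      then have "int p dvd half_trace k ^ (p + 2)" using p by simp
      then show False using cop 3
        by (metis coprime_common_divisor coprime_power_right_iff dvd_refl not_prime_unit p prime_nat_int_transfer)
    qed
  qed
qed

text \<open>Each prime divides some term exactly to the first power, \<open>U\<^sub>p\<close>, and from there on every further factor \<open>p\<close>
of a term costs a factor \<open>p\<close> of the index. The case \<open>p\<^sup>1\<close> does not involve \<open>U\<^sub>p\<close> modulo \<open>p\<^sup>2\<close>, which is why 9 matters
only when it divides \<open>M\<close>.\<close>
lemma dvd_U_imp_dvd_index:
  assumes "M > 0" and D: "\<And>p. prime p \<Longrightarrow> p dvd M \<Longrightarrow> int p dvd pell_D k"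
    and 9: "\<not> (9 dvd M \<and> 9 dvd U k 3)" and "int M dvd U k s"
  shows "M dvd s"
proof (rule prime_power_divisors_imp_dvd)
  fix p c assume p: "prime p" and c: "p ^ Suc c dvd M"
  then have pD: "int p dvd pell_D k" using D by (metis dvd_mult_left power_Suc)
  have cU: "int p ^ Suc c dvd U k s"
    using c assms(4) by (metis dvd_trans int_dvd_int_iff of_nat_power)
  then have "p dvd s" using prime_dvd_U_iff [OF p pD] by (metis dvd_mult_left power_Suc)
  then obtain n where s: "s = n * p" by (metis dvdE mult.commute)
  show "p ^ Suc c dvd s"
  proof (cases c)
    case 0
    then show ?thesis using \<open>p dvd s\<close> by simp
  next
    case (Suc d)
    have "p = 3 \<longrightarrow> 9 dvd M"
    proof
      assume 3: "p = 3"
      have "(3::nat) ^ 2 dvd 3 ^ Suc c" using Suc by (intro le_imp_power_dvd) simp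
      then show "9 dvd M" using c unfolding 3 by (auto intro: dvd_trans)
    qed
    then have "\<not> int p ^ 2 dvd U k p" using not_prime_square_dvd_U [OF p pD] 9 by blast
    then have "p ^ c dvd n"
      using exact_lift [OF p, of 0 k p c n] prime_dvd_U_iff [OF p pD] cU
      by (simp add: s power2_eq_square)
    then show ?thesis by (simp add: s)
  qed
qed (use assms in simp)

section \<open>Periods, antiperiods and collisions\<close>

definition discriminates :: "nat \<Rightarrow> nat \<Rightarrow> nat \<Rightarrow> bool" where
  "discriminates k m n \<longleftrightarrow> m \<ge> 1 \<and> (\<forall>i<n. \<forall>j<n. i \<noteq> j \<longrightarrow> \<not> [U k i = U k j] (mod int m))"

text \<open>The index \<open>N\<close> corresponds to a power of the unit that is \<open>+1\<close> (or \<open>-1\<close>, for \<open>antiperiod\<close>) modulo \<open>q\<close>. In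
the first case \<open>j \<mapsto> j + N\<close> preserves the residues of the sequence, in the second case \<open>j \<mapsto> N - j\<close> does.\<close>
definition period :: "nat \<Rightarrow> nat \<Rightarrow> nat \<Rightarrow> bool" where
  "period k q N \<longleftrightarrow> int q dvd U k N \<and> int q dvd T k N - 1"

definition antiperiod :: "nat \<Rightarrow> nat \<Rightarrow> nat \<Rightarrow> bool" where
  "antiperiod k q N \<longleftrightarrow> int q dvd U k N \<and> int q dvd T k N + 1"

lemma discriminatesI:
  assumes "m \<ge> 1" "\<And>i j. j < i \<Longrightarrow> i < n \<Longrightarrow> int m dvd U k i - U k j \<Longrightarrow> False"
  shows "discriminates k m n"
  unfolding discriminates_def cong_iff_dvd_diff
  using assms by (metis dvd_diff_commute linorder_neqE_nat)

lemma discriminatesD: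
  assumes "discriminates k m n" "j < i" "int m dvd U k i - U k j"
  shows "n \<le> i"
  using assms unfolding discriminates_def cong_iff_dvd_diff
  by (metis linorder_not_less order_less_trans nat_neq_iff)

lemma discriminates_le_rank:
  assumes "discriminates k m n" "t > 0" "int m dvd U k t"
  shows "n \<le> t"
  using discriminatesD [OF assms(1,2)] assms(3) by simp

lemma period_shift: "period k q N \<Longrightarrow> int q dvd U k (j + N) - U k j"
proof -
  assume "period k q N"
  moreover have "U k (j + N) - U k j = U k j * (T k N - 1) + T k j * U k N"
    by (simp add: U_add algebra_simps)
  ultimately show ?thesis by (simp add: period_def)
qed

lemma antiperiod_reflect: "antiperiod k q N \<Longrightarrow> j \<le> N \<Longrightarrow> int q dvd U k (N - j) - U k j"
proof -
  assume "antiperiod k q N" "j \<le> N"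
  moreover from this have "U k (N - j) - U k j = U k N * T k j - U k j * (T k N + 1)"
    by (simp add: U_diff algebra_simps)
  ultimately show ?thesis by (simp add: antiperiod_def)
qed

lemma period_mult:
  assumes "period k q N" shows "period k q (n * N)"
proof -
  have d: "int q dvd U k N" and "[T k N = 1] (mod int q)"
    using assms by (simp_all add: period_def cong_iff_dvd_diff)
  then have "[T k N ^ n = 1 ^ n] (mod int q)" by (intro cong_pow)
  then have "[T k (n * N) = 1] (mod int q)" using T_mult_cong [OF d] cong_trans by force
  then show ?thesis using d by (simp add: period_def cong_iff_dvd_diff dvd_U_mult)
qed

lemma antiperiod_mult:
  assumes "antiperiod k q N" "odd n" shows "antiperiod k q (n * N)"
proof -
  have d: "int q dvd U k N" and "[T k N = - 1] (mod int q)"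
    using assms(1) by (simp_all add: antiperiod_def cong_iff_dvd_diff)
  then have "[T k N ^ n = (- 1) ^ n] (mod int q)" by (intro cong_pow)
  then have "[T k (n * N) = - 1] (mod int q)" using T_mult_cong [OF d] cong_trans assms(2) by force
  then show ?thesis using d by (simp add: antiperiod_def cong_iff_dvd_diff dvd_U_mult)
qed

lemma period_coprime_mult:
  assumes "period k q N" "period k q' N'" "coprime q q'"
  shows "period k (q * q') (N * N')"
proof -
  have "period k q (N * N')" "period k q' (N * N')"
    using assms period_mult by (metis mult.commute)+
  with assms(3) show ?thesis by (auto simp: period_def intro: divides_mult)
qed

lemma antiperiod_coprime_mult:
  assumes "antiperiod k q N" "antiperiod k q' N'" "coprime q q'" "odd N" "odd N'"
  shows "antiperiod k (q * q') (N * N')"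
proof -
  have "antiperiod k q (N * N')" "antiperiod k q' (N * N')"
    using assms antiperiod_mult by (metis mult.commute)+
  with assms(3) show ?thesis by (auto simp: antiperiod_def intro: divides_mult)
qed

lemma coprime_int_primeI:
  assumes "\<And>p. prime p \<Longrightarrow> p dvd q \<Longrightarrow> int p dvd y \<Longrightarrow> False"
  shows "coprime (int q) y"
proof (rule ccontr)
  assume "\<not> coprime (int q) y"
  then have "nat (gcd (int q) y) \<noteq> 1" by (simp add: coprime_iff_gcd_eq_1)
  then obtain p where p: "prime p" "p dvd nat (gcd (int q) y)" using prime_factor_nat by blast
  then have "int p dvd gcd (int q) y" by (metis gcd_ge_0_int int_dvd_int_iff nat_0_le)
  then show False using assms p(1) by auto
qed

text \<open>Applied to \<open>x = T\<^sub>N - 1\<close> and \<open>y = T\<^sub>N + 1\<close>, or the other way round: their product is \<open>D U\<^sub>N\<^sup>2\<close>, so if \<open>q\<close>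
divides \<open>U\<^sub>N\<close> and is prime to one factor, it divides the other. A congruence modulo the primes of \<open>q\<close>
thus decides the sign modulo \<open>q\<close> itself.\<close>
lemma coprime_shift_two:
  assumes "\<And>p. prime p \<Longrightarrow> p dvd q \<Longrightarrow> odd p \<and> int p dvd x" and y: "\<bar>y - x\<bar> = 2"
  shows "coprime (int q) y"
proof (rule coprime_int_primeI)
  fix p assume p: "prime p" "p dvd q" "int p dvd y"
  then have x: "odd p" "int p dvd x" using assms(1) by auto
  then have "int p dvd \<bar>y - x\<bar>" using p(3) by simp
  then have "p dvd 2" unfolding y by (metis int_dvd_int_iff of_nat_numeral)
  then show False using x(1) p(1) primes_dvd_imp_eq two_is_prime_nat by blast
qed

lemma periodI:
  assumes "int q dvd U k N" "\<And>p. prime p \<Longrightarrow> p dvd q \<Longrightarrow> odd p \<and> int p dvd T k N - 1"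
  shows "period k q N"
proof -
  have "coprime (int q) (T k N + 1)"
    by (rule coprime_shift_two [of _ "T k N - 1"]) (use assms in auto)
  moreover have "int q dvd (T k N + 1) * (T k N - 1)"
    using pell_factor [of k N] assms(1) by (simp add: mult.commute power2_eq_square)
  ultimately show ?thesis using assms(1) by (simp add: period_def coprime_dvd_mult_right_iff)
qed

lemma antiperiodI:
  assumes "int q dvd U k N" "\<And>p. prime p \<Longrightarrow> p dvd q \<Longrightarrow> odd p \<and> int p dvd T k N + 1"
  shows "antiperiod k q N"
proof -
  have "coprime (int q) (T k N - 1)"
    by (rule coprime_shift_two [of _ "T k N + 1"]) (use assms in auto)
  moreover have "int q dvd (T k N - 1) * (T k N + 1)"
    using pell_factor [of k N] assms(1) by (simp add: power2_eq_square)
  ultimately show ?thesis using assms(1) by (simp add: antiperiod_def coprime_dvd_mult_right_iff)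
qed

text \<open>Two symmetries of the index clash: \<open>i\<close> and \<open>j\<close> with \<open>i - j = N\<close> and \<open>i + j\<close> an odd multiple of \<open>N'\<close> have the
same residue for both parts of the modulus. The least odd multiple that is at least \<open>N\<close> gives the
bound; it is \<open>N'\<close> itself unless \<open>N' < N\<close>.\<close>
lemma collision:
  assumes d: "discriminates k (q * q') n" and co: "coprime q q'"
    and per: "period k q N" "N > 0" and anti: "antiperiod k q' N'" "N' > 0"
    and par: "even N \<longleftrightarrow> even N'"
  shows "2 * n \<le> N + N' \<or> N' < N \<and> n + 1 \<le> N + N'"
proof -
  \<comment> \<open>\<open>2c + 1\<close> is the least odd factor with \<open>(2c + 1) N' \<ge> N\<close>.\<close>
  define c where "c = (N + N' - 1) div (2 * N')"
  have c: "2 * N' * c \<le> N + N' - 1" "N + N' - 1 < 2 * N' * (c + 1)"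
    unfolding c_def using dividend_less_times_div [of "2 * N'" "N + N' - 1"] anti(2) by simp_all
  define R where "R = (2 * c + 1) * N'"
  have NR: "N \<le> R" using c(2) by (simp add: R_def algebra_simps)
  have R: "R + 1 \<le> N + 2 * N'" using c(1) anti(2) per(2) by (simp add: R_def algebra_simps)
  have evR: "even (R + N)" using par by (simp add: R_def)
  define i where "i = (R + N) div 2"
  define j where "j = (R - N) div 2"
  have i: "2 * i = R + N" using evR by (simp add: i_def)
  have j: "2 * j = R - N" using evR NR by (simp add: j_def)
  have ij: "i = j + N" "j \<le> R" "R - j = i" using i j NR by linarith+
  have "antiperiod k q' R" unfolding R_def by (rule antiperiod_mult [OF anti(1)]) simp
  then have "int q' dvd U k i - U k j" using antiperiod_reflect ij by metis
  moreover have "int q dvd U k i - U k j" using period_shift [OF per(1)] ij by metis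
  ultimately have "int (q * q') dvd U k i - U k j" using co by (simp add: divides_mult)
  then have n: "n \<le> i" using discriminatesD [OF d, of j i] ij(1) per(2) by linarith
  show ?thesis
  proof (cases "N' < N")
    case True
    have "2 * i + 1 \<le> 2 * (N + N')" using i R by simp
    then have "i + 1 \<le> N + N'" by presburger
    then show ?thesis using n True by simp
  next
    case False
    have "c = 0"
    proof (rule ccontr)
      assume "c \<noteq> 0"
      then have "2 * N' * 1 \<le> 2 * N' * c" by (intro mult_le_mono2) simp
      then show False using c(1) False per(2) by linarith
    qed
    then show ?thesis using i n by (simp add: R_def)
  qed
qed

section \<open>The sets of the theorem in terms of primes\<close>

lemma prime_dvd_pell_D_iff: "prime p \<Longrightarrow> int p dvd pell_D k \<longleftrightarrow> p dvd k * (k + 1)"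
proof -
  assume p: "prime p"
  have "pell_D k = int (2 * 2 * (k * (k + 1)))" by (simp add: pell_D_def algebra_simps)
  then have "int p dvd pell_D k \<longleftrightarrow> p dvd 2 * 2 * (k * (k + 1))" by (simp only: int_dvd_int_iff)
  also have "\<dots> \<longleftrightarrow> p dvd k * (k + 1)"
  proof (cases "p = 2")
    case False
    then have "\<not> p dvd 2" using p primes_dvd_imp_eq two_is_prime_nat by blast
    then show ?thesis using p prime_dvd_mult_iff by blast
  qed simp
  finally show ?thesis .
qed

text \<open>Since \<open>U\<^sub>3 = (4k+1)(4k+3)\<close>, the special residues of \<open>k\<close> modulo 9 and 25 are those for which the square of 3
or 5 divides \<open>U\<^sub>3\<close>. Both are found by running through the residues.\<close>
lemma dvd_U_3_mod: "int d dvd U k 3 \<longleftrightarrow> d dvd (4 * (k mod d) + 1) * (4 * (k mod d) + 3)"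
proof -
  have "U k 3 = int ((4 * k + 1) * (4 * k + 3))" by (simp add: U_3 algebra_simps)
  then have "int d dvd U k 3 \<longleftrightarrow> d dvd (4 * k + 1) * (4 * k + 3)" by (simp only: int_dvd_int_iff)
  also have "[(4 * k + 1) * (4 * k + 3) = (4 * (k mod d) + 1) * (4 * (k mod d) + 3)] (mod d)"
    by (intro cong_mult cong_add cong_refl) (simp_all add: cong_def mod_mult_right_eq)
  then have "d dvd (4 * k + 1) * (4 * k + 3) \<longleftrightarrow> d dvd (4 * (k mod d) + 1) * (4 * (k mod d) + 3)"
    by (rule cong_dvd_iff)
  finally show ?thesis .
qed

lemma nine_dvd_U_3: "9 dvd U k 3 \<longleftrightarrow> [k = 6] (mod 9) \<or> [k = 2] (mod 9)"
proof -
  have "k mod 9 < 9" by simp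
  then have "k mod 9 \<in> {0,1,2,3,4,5,6,7,8}" by auto
  then show ?thesis using dvd_U_3_mod [of 9 k] by (auto simp: cong_def)
qed

lemma twentyfive_dvd_U_3: "25 dvd U k 3 \<longleftrightarrow> [k = 6] (mod 25) \<or> [k = 18] (mod 25)"
proof -
  have "k mod 25 < 25" by simp
  then have "k mod 25 \<in> {0,1,2,3,4,5,6,7,8,9,10,11,12,13,14,15,16,17,18,19,20,21,22,23,24}" by simp presburger
  then show ?thesis using dvd_U_3_mod [of 25 k] by (auto simp: cong_def)
qed

lemma setB_iff:
  "m \<in> setB k \<longleftrightarrow> m \<ge> 1 \<and> even m \<and> \<not> (9 dvd m \<and> 9 dvd U k 3)
     \<and> (\<forall>p. prime p \<longrightarrow> p dvd m \<longrightarrow> p dvd k * (k + 1))"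
  unfolding setB_def nine_dvd_U_3 by auto

text \<open>For \<open>k \<equiv> 2 (mod 9)\<close> the clause about 9 holds automatically, as 3 does not divide \<open>k\<close>; so the same
description serves for all \<open>k\<close>.\<close>
lemma setA_iff:
  "m \<in> setA k \<longleftrightarrow> m \<ge> 1 \<and> odd m \<and> \<not> (9 dvd m \<and> 9 dvd U k 3)
     \<and> (\<forall>p. prime p \<longrightarrow> p dvd m \<longrightarrow> p dvd k)"
proof -
  have "\<not> 3 dvd k" if "[k = 2] (mod 9)"
    using that by (auto simp: cong_def) presburger
  moreover have "3 dvd m" if "9 dvd m" using that by presburger
  moreover have "prime (3::nat)" by simp
  ultimately show ?thesis unfolding setA_def nine_dvd_U_3
    by (cases "[k = 6] (mod 9)"; cases "[k = 2] (mod 9)") auto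
qed

lemma setB_smooth: "m \<in> setB k \<Longrightarrow> prime p \<Longrightarrow> p dvd m \<Longrightarrow> int p dvd pell_D k"
  by (simp add: setB_iff prime_dvd_pell_D_iff)

lemma setA_smooth: "m \<in> setA k \<Longrightarrow> prime p \<Longrightarrow> p dvd m \<Longrightarrow> int p dvd pell_D k"
  by (simp add: setA_iff prime_dvd_pell_D_iff)

section \<open>Moduli that separate many terms\<close>

text \<open>Modulo a divisor of \<open>k\<close> one has \<open>w \<equiv> 1\<close>, hence \<open>T\<^sub>n \<equiv> 1\<close>; modulo a divisor of \<open>k + 1\<close> one has \<open>w \<equiv> -1\<close>, hence
\<open>T\<^sub>n \<equiv> (-1)\<^sup>n\<close>. So the odd primes of \<open>k\<close> give periods and those of \<open>k + 1\<close> give antiperiods.\<close>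
lemma period_of_dvd_k:
  assumes "m > 0" "odd m" "\<And>p. prime p \<Longrightarrow> p dvd m \<Longrightarrow> p dvd k"
  shows "period k m m"
proof (rule periodI)
  show "int m dvd U k m" by (rule dvd_U_self) (use assms prime_dvd_pell_D_iff in auto)
  fix p assume p: "prime p" "p dvd m"
  then have pk: "p dvd k" and "int p dvd pell_D k" using assms prime_dvd_pell_D_iff by auto
  then have "[T k m = half_trace k ^ m] (mod int p)" using first_order_mod_pell_D(2) cong_dvd_modulus by blast
  moreover have "[half_trace k = 1] (mod int p)" using pk by (simp add: half_trace_def cong_iff_dvd_diff)
  then have "[half_trace k ^ m = 1 ^ m] (mod int p)" by (rule cong_pow)
  ultimately have "[T k m = 1] (mod int p)" using cong_trans by force
  moreover have "odd p" using assms(2) p(2) by (metis dvd_trans)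
  ultimately show "odd p \<and> int p dvd T k m - 1" by (simp add: cong_iff_dvd_diff)
qed

lemma antiperiod_of_dvd_Suc_k:
  assumes "m > 0" "odd m" "\<And>p. prime p \<Longrightarrow> p dvd m \<Longrightarrow> p dvd k + 1"
  shows "antiperiod k m m"
proof (rule antiperiodI)
  show "int m dvd U k m" by (rule dvd_U_self) (use assms prime_dvd_pell_D_iff dvd_mult in blast)+
  fix p assume p: "prime p" "p dvd m"
  then have pk: "p dvd k + 1" and "int p dvd pell_D k" using assms prime_dvd_pell_D_iff dvd_mult by blast+
  then have "[T k m = half_trace k ^ m] (mod int p)" using first_order_mod_pell_D(2) cong_dvd_modulus by blast
  moreover have "half_trace k - (- 1) = 2 * int (k + 1)" by (simp add: half_trace_def)
  then have "[half_trace k = - 1] (mod int p)" unfolding cong_iff_dvd_diff using pk by (metis dvd_mult int_dvd_int_iff)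
  then have "[half_trace k ^ m = (- 1) ^ m] (mod int p)" by (rule cong_pow)
  ultimately have "[T k m = - 1] (mod int p)" using cong_trans assms(2) by force
  moreover have "odd p" using assms(2) p(2) by (metis dvd_trans)
  ultimately show "odd p \<and> int p dvd T k m + 1" by (simp add: cong_iff_dvd_diff)
qed

lemma U_diff_same_parity:
  assumes "j \<le> i" "even (i - j)"
  obtains r s where "i - j = 2 * s" "U k i - U k j = 2 * U k s * T k r"
proof -
  obtain s where s: "i - j = 2 * s" using assms(2) by blast
  then have "U k ((j + s) + s) - U k ((j + s) - s) = 2 * U k s * T k (j + s)" by (intro U_symm_diff) simp
  moreover have "(j + s) + s = i" "(j + s) - s = j" using s assms(1) by auto
  ultimately show ?thesis using s that by metis
qed

text \<open>Here \<open>U\<^sub>i - U\<^sub>j = 2 U\<^sub>s T\<^sub>r\<close> with \<open>2s = i - j\<close>, and both 2 and \<open>T\<^sub>r\<close> are units modulo \<open>m\<close>.\<close>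
lemma dvd_index_diff_odd:
  assumes m: "m \<ge> 1" "odd m" "\<And>p. prime p \<Longrightarrow> p dvd m \<Longrightarrow> int p dvd pell_D k"
    and 9: "\<not> (9 dvd m \<and> 9 dvd U k 3)" and ij: "j \<le> i" "even (i - j)" and d: "int m dvd U k i - U k j"
  shows "m dvd i - j"
proof -
  obtain r s where s: "i - j = 2 * s" and rs: "U k i - U k j = 2 * U k s * T k r"
    using U_diff_same_parity [OF ij] by metis
  have "coprime (int m) (T k r)"
  proof (rule coprime_int_primeI)
    fix p assume p: "prime p" "p dvd m" "int p dvd T k r"
    then have "coprime (int p) (T k r)" using coprime_T m(3) by blast
    with p show False by (metis coprime_common_divisor dvd_refl not_prime_unit prime_nat_int_transfer)
  qed
  moreover have "coprime (int m) 2" using m(2) by simp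
  ultimately have "int m dvd U k s" using d unfolding rs
    by (simp add: coprime_dvd_mult_left_iff coprime_dvd_mult_right_iff)
  then have "m dvd s" using m 9 by (intro dvd_U_imp_dvd_index) auto
  then show ?thesis unfolding s by simp
qed


text \<open>An even modulus forces equal parity of the indices, since \<open>U\<^sub>n\<close> and \<open>n\<close> have the same parity.\<close>
lemma discriminates_even:
  assumes "m \<ge> 1" "even m" "n \<le> N"
    and "\<And>i j. j \<le> i \<Longrightarrow> even (i - j) \<Longrightarrow> int m dvd U k i - U k j \<Longrightarrow> N dvd i - j"
  shows "discriminates k m n"
proof (rule discriminatesI)
  fix i j assume ij: "j < i" "i < n" and d: "int m dvd U k i - U k j"
  have "int 2 dvd int m" using assms(2) by simp
  then have "int 2 dvd U k i - U k j" using d by (rule dvd_trans)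
  moreover have "even (U k x) \<longleftrightarrow> even x" for x
    using prime_dvd_U_iff [of 2 k x] prime_dvd_pell_D_iff [of 2 k] by simp
  ultimately have "even (i - j)" using ij(1) by simp
  then have "N dvd i - j" using assms(4) [OF less_imp_le [OF ij(1)]] d by blast
  then show False using ij assms(3) by (auto dest: dvd_imp_le)
qed (use assms in simp)

text \<open>An odd period turns a collision between indices of different parity into one between indices of equal
parity.\<close>
lemma discriminates_odd:
  assumes "m \<ge> 1" "period k m N" "odd N" "n \<le> N"
    and "\<And>i j. j \<le> i \<Longrightarrow> even (i - j) \<Longrightarrow> int m dvd U k i - U k j \<Longrightarrow> N dvd i - j"
  shows "discriminates k m n"
proof (rule discriminatesI)
  fix i j assume ij: "j < i" "i < n" and d: "int m dvd U k i - U k j"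
  have "N dvd i - j"
  proof (cases "even (i - j)")
    case False
    have "int m dvd (U k (i + N) - U k i) + (U k i - U k j)"
      using period_shift [OF assms(2)] d by (rule dvd_add)
    then have "int m dvd U k (i + N) - U k j" by simp
    moreover have "even (i + N - j)" "j \<le> i + N" using False ij(1) assms(3) by auto
    ultimately have "N dvd i + N - j" using assms(5) by blast
    moreover have "i + N - j = (i - j) + N" using ij(1) by simp
    ultimately show ?thesis by simp
  qed (use assms(5) ij(1) d in simp)
  then show False using ij assms(4) by (auto dest: dvd_imp_le)
qed (use assms in simp)

text \<open>One factor 2 of \<open>m\<close> is absorbed by \<open>i - j = 2s\<close>, and the factor 2 in \<open>2 U\<^sub>s T\<^sub>r\<close> compensates for it, so the
divisibility of \<open>U\<^sub>s\<close> is only needed for \<open>m/2\<close>.\<close>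
lemma dvd_index_diff_even:
  assumes B: "m \<in> setB k" and ij: "j \<le> i" "even (i - j)" and d: "int m dvd U k i - U k j"
  shows "m dvd i - j"
proof -
  obtain m' where m': "m = 2 * m'" using B by (auto simp: setB_iff)
  obtain r s where s: "i - j = 2 * s" and rs: "U k i - U k j = 2 * U k s * T k r"
    using U_diff_same_parity [OF ij] by metis
  have "int m' dvd U k s * T k r" using d unfolding rs m' by (simp add: mult.assoc)
  moreover have "coprime (int m') (T k r)"
  proof (rule coprime_int_primeI)
    fix p assume p: "prime p" "p dvd m'" "int p dvd T k r"
    then have "coprime (int p) (T k r)" using coprime_T setB_smooth [OF B] m' by (meson dvd_mult)
    with p show False by (metis coprime_common_divisor dvd_refl not_prime_unit prime_nat_int_transfer)
  qed
  ultimately have "int m' dvd U k s" by (simp add: coprime_dvd_mult_left_iff)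
  then have "m' dvd s"
  proof (rule dvd_U_imp_dvd_index [rotated -1])
    show "m' > 0" using B m' by (simp add: setB_iff)
    show "int p dvd pell_D k" if "prime p" "p dvd m'" for p
      using setB_smooth [OF B] that m' by (meson dvd_mult)
    show "\<not> (9 dvd m' \<and> 9 dvd U k 3)" using B m' by (auto simp: setB_iff)
  qed
  then show ?thesis unfolding s m' by simp
qed

lemma discriminates_setB: "m \<in> setB k \<Longrightarrow> n \<le> m \<Longrightarrow> discriminates k m n"
  by (rule discriminates_even [where N = m]) (auto simp: setB_iff intro: dvd_index_diff_even)

lemma dvd_index_diff_setA:
  "m \<in> setA k \<Longrightarrow> j \<le> i \<Longrightarrow> even (i - j) \<Longrightarrow> int m dvd U k i - U k j \<Longrightarrow> m dvd i - j"
  using dvd_index_diff_odd [of m k] setA_smooth [of m k] by (simp add: setA_iff)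

lemma period_setA: "m \<in> setA k \<Longrightarrow> period k m m"
  using period_of_dvd_k [of m k] by (simp add: setA_iff)

lemma discriminates_setA: "m \<in> setA k \<Longrightarrow> n \<le> m \<Longrightarrow> discriminates k m n"
  by (rule discriminates_odd [where N = m])
    (use dvd_index_diff_setA period_setA in \<open>auto simp: setA_iff\<close>)

lemma U_T_mod_5:
  assumes "[k = 1] (mod 5) \<or> [k = 3] (mod 5)"
  shows "5 dvd U k 3" "\<not> 5 dvd U k 1" "\<not> 5 dvd U k 2"
    "[k = 1] (mod 5) \<Longrightarrow> 5 dvd T k 3 + 1" "[k = 3] (mod 5) \<Longrightarrow> 5 dvd T k 3 - 1"
proof -
  have "\<exists>q. k = 5 * q + 1 \<or> k = 5 * q + 3"
  proof -
    have "k mod 5 = 1 \<or> k mod 5 = 3" using assms by (simp add: cong_def)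
    then show ?thesis by presburger
  qed
  then obtain q where q: "k = 5 * q + 1 \<or> k = 5 * q + 3" by blast
  show "5 dvd U k 3" using q unfolding U_3 by (auto intro: dvd_mult dvd_mult2)
  show "\<not> 5 dvd U k 1" by simp
  show "\<not> 5 dvd U k 2" using q unfolding U_2 half_trace_def by (elim disjE) (simp, presburger)+
  show "5 dvd T k 3 + 1" if "[k = 1] (mod 5)"
  proof -
    have k: "k = 5 * q + 1" using q that by (auto simp: cong_def)
    have "T k 3 + 1 = 5 * (800 * int q ^ 3 + 720 * int q ^ 2 + 210 * int q + 20)"
      unfolding T_3 half_trace_def k by (simp add: power2_eq_square power3_eq_cube algebra_simps)
    then show ?thesis by simp
  qed
  show "5 dvd T k 3 - 1" if "[k = 3] (mod 5)"
  proof -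
    have k: "k = 5 * q + 3" using q that by (auto simp: cong_def)
    have "T k 3 - 1 = 5 * (800 * int q ^ 3 + 1680 * int q ^ 2 + 1170 * int q + 270)"
      unfolding T_3 half_trace_def k by (simp add: power2_eq_square power3_eq_cube algebra_simps)
    then show ?thesis by simp
  qed
qed

text \<open>The prime 5 has rank 3. It never divides \<open>T\<^sub>r\<close>: otherwise it divides \<open>U\<^sub>2\<^sub>r\<close>, so 3 divides \<open>2r\<close> and
\<open>r\<close>, and 5 divides \<open>U\<^sub>r\<close> as well, contrary to the norm equation.\<close>
lemma five_power_dvd_index_diff:
  assumes k: "[k = 1] (mod 5) \<or> [k = 3] (mod 5)" and 25: "\<not> 25 dvd U k 3"
    and ij: "j \<le> i" "even (i - j)" and d: "int (5 ^ Suc b) dvd U k i - U k j"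
  shows "3 * 5 ^ b dvd i - j"
proof -
  have rank: "3 dvd s" if "5 dvd U k s" for s
  proof -
    define q x where "q = s div 3" and "x = s mod 3"
    have s: "s = q * 3 + x" by (simp add: q_def x_def)
    have q3: "5 dvd U k (q * 3)" using U_T_mod_5(1) [OF k] dvd_U_mult by blast
    have "5 dvd T k (q * 3) * U k x"
      using that q3 unfolding s U_add by (simp add: dvd_add_right_iff)
    moreover have "coprime 5 (T k (q * 3))" using q3 coprime_T by blast
    ultimately have "5 dvd U k x" by (simp add: coprime_dvd_mult_right_iff)
    moreover have "x = 0 \<or> x = 1 \<or> x = 2" unfolding x_def by presburger
    ultimately have "x = 0" using U_T_mod_5(2,3) [OF k] by auto
    then show ?thesis using s by simp
  qed
  obtain r s where s: "i - j = 2 * s" and rs: "U k i - U k j = 2 * U k s * T k r"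
    using U_diff_same_parity [OF ij] by metis
  have nT: "\<not> 5 dvd T k r"
  proof
    assume a: "5 dvd T k r"
    then have "5 dvd U k (2 * r)" by (simp add: U_double)
    then have "3 dvd 2 * r" using rank by blast
    then have "3 dvd r" by presburger
    then have "5 dvd U k r" using U_T_mod_5(1) [OF k] dvd_U_mult(2) by blast
    then have "coprime 5 (T k r)" using coprime_T by blast
    with a show False by (simp add: coprime_absorb_left)
  qed
  have "prime (int 5)" by simp
  then have "coprime (5::int) (T k r)" using nT prime_imp_coprime [of 5 "T k r"] by simp
  then have "coprime (int (5 ^ Suc b)) (2 * T k r)" by simp
  moreover have "int (5 ^ Suc b) dvd U k s * (2 * T k r)" using d unfolding rs by (simp add: mult_ac)
  ultimately have Us: "int 5 ^ Suc b dvd U k s" by (simp only: coprime_dvd_mult_left_iff of_nat_power)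
  then have "int 5 dvd U k s" by (metis dvd_mult_left power_Suc)
  then have "3 dvd s" using rank by simp
  then obtain n where n: "s = n * 3" by (metis dvdE mult.commute)
  have "5 ^ b dvd n"
    by (rule exact_lift [of 5 0 k 3 b n]) (use Us n U_T_mod_5(1) [OF k] 25 in simp_all)
  then show ?thesis unfolding s n by (auto simp: mult_ac)
qed

lemma coprime_3_5:
  assumes "[k = 1] (mod 3)" "[k = 1] (mod 5) \<or> [k = 3] (mod 5)"
    and "\<And>p. prime p \<Longrightarrow> p dvd a \<Longrightarrow> p dvd k * (k + 1)"
  shows "coprime a (3::nat)" "coprime a (5::nat)"
proof -
  have "k mod 3 = 1" using assms(1) by (simp add: cong_def)
  then have "\<not> 3 dvd k" "\<not> 3 dvd k + 1" by presburger+
  moreover have "k mod 5 = 1 \<or> k mod 5 = 3" using assms(2) by (simp add: cong_def)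
  then have "\<not> 5 dvd k" "\<not> 5 dvd k + 1" by presburger+
  moreover have p: "prime (3::nat)" "prime (5::nat)" by simp_all
  ultimately have "\<not> 3 dvd k * (k + 1)" "\<not> 5 dvd k * (k + 1)" using prime_dvd_mult_iff by blast+
  then have "\<not> 3 dvd a" "\<not> 5 dvd a" using assms(3) p by blast+
  then show "coprime a (3::nat)" "coprime a (5::nat)"
    using p by (metis coprime_commute prime_imp_coprime)+
qed

text \<open>The parts \<open>a\<close> and \<open>5\<^sup>b\<^sup>+\<^sup>1\<close> force the index difference to be divisible by \<open>a\<close> and by \<open>3\<cdot>5\<^sup>b\<close>, which are coprime
because \<open>k \<equiv> 1 (mod 3)\<close>. For odd \<open>a\<close> an odd period is needed in addition, and \<open>3\<cdot>5\<^sup>b\<close> is a period only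
for \<open>k \<equiv> 3 (mod 5)\<close>; it is an antiperiod for \<open>k \<equiv> 1 (mod 5)\<close>.\<close>
lemma discriminates_times_5_power:
  assumes k: "[k = 1] (mod 3)" "[k = 1] (mod 5) \<or> [k = 3] (mod 5)" and 25: "\<not> 25 dvd U k 3"
    and n: "5 * n \<le> 3 * (a * 5 ^ Suc b)"
    and a: "a \<in> setB k \<or> a \<in> setA k \<and> [k = 3] (mod 5)"
  shows "discriminates k (a * 5 ^ Suc b) n"
proof -
  have sm: "p dvd k * (k + 1)" if "prime p" "p dvd a" for p
    using a that by (auto simp: setA_iff setB_iff)
  have co: "coprime a 3" "coprime a 5" using coprime_3_5 [OF k sm] by auto
  define N where "N = a * (3 * 5 ^ b)"
  have a1: "a \<ge> 1" using a by (auto simp: setA_iff setB_iff)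
  have nN: "n \<le> N" using n by (simp add: N_def)
  have N: "N dvd i - j" if "j \<le> i" "even (i - j)" "int (a * 5 ^ Suc b) dvd U k i - U k j" for i j
  proof -
    have "int a dvd U k i - U k j" "int (5 ^ Suc b) dvd U k i - U k j"
      using that(3) by (metis dvd_mult_left dvd_mult_right of_nat_mult)+
    then have "a dvd i - j" "3 * 5 ^ b dvd i - j"
      using a that dvd_index_diff_even dvd_index_diff_setA five_power_dvd_index_diff [OF k(2) 25] by blast+
    moreover have "coprime a (3 * 5 ^ b)" using co by simp
    ultimately show ?thesis unfolding N_def by (rule divides_mult)
  qed
  show ?thesis
  proof (cases "even a")
    case True
    show ?thesis by (rule discriminates_even [OF _ _ nN]) (use True a1 N in auto)
  next
    case False
    then have A: "a \<in> setA k" "[k = 3] (mod 5)" using a by (auto simp: setB_iff)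
    have "int 5 ^ Suc 0 dvd U k 3" using U_T_mod_5(1) [OF k(2)] by simp
    from prime_power_lift [OF this, of b] have d5: "int (5 ^ Suc b) dvd U k (5 ^ b * 3)" by simp
    have "period k (5 ^ Suc b) (5 ^ b * 3)"
    proof (rule periodI [OF d5])
      fix p :: nat assume p: "prime p" "p dvd 5 ^ Suc b"
      have "prime (5::nat)" by simp
      then have "p = 5" using p by (metis prime_dvd_power primes_dvd_imp_eq)
      moreover have "period k 5 3" using U_T_mod_5(1,5) [OF k(2)] A(2) by (simp add: period_def)
      then have "period k 5 (5 ^ b * 3)" by (rule period_mult)
      ultimately show "odd p \<and> int p dvd T k (5 ^ b * 3) - 1" by (simp add: period_def)
    qed
    moreover have "coprime a (5 ^ Suc b)" using co by simp
    ultimately have "period k (a * 5 ^ Suc b) (a * (5 ^ b * 3))"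
      using period_setA [OF A(1)] period_coprime_mult by blast
    then have "period k (a * 5 ^ Suc b) N" by (simp add: N_def mult_ac)
    moreover have "odd N" using False by (simp add: N_def)
    ultimately show ?thesis using a1 nN N by (intro discriminates_odd [of _ k N]) auto
  qed
qed

section \<open>Numbers composed of 2, 3 and 5 in short intervals\<close>

text \<open>The hypotheses say that \<open>x = p\<^sup>b\<^sup>+\<^sup>1 / 2\<^sup>E\<close> lies in the narrow range from \<open>p/(p+1)\<close> to 1, and the claim asks for a
number \<open>2\<^sup>a 5\<^sup>f\<^sup>+\<^sup>1 / 2\<^sup>E\<close> between \<open>(5/6)(1 + 1/p) x\<close> and \<open>x\<close>. The powers \<open>5\<^sup>3, 5\<^sup>6, 5\<^sup>9, 5\<^sup>1\<^sup>2\<close>, scaled by \<open>2\<^sup>-\<^sup>7, 2\<^sup>-\<^sup>1\<^sup>4,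
2\<^sup>-\<^sup>2\<^sup>1, 2\<^sup>-\<^sup>2\<^sup>8\<close>, are about 0.977, 0.954, 0.931 and 0.909. The last one lies below \<open>13/14\<close> and works for
every \<open>x\<close>, but it is available only for \<open>E \<ge> 29\<close>, since \<open>a \<ge> 1\<close> is required. For smaller \<open>E\<close> the larger ones
settle all but a few values of \<open>x\<close>, which bound \<open>p\<close> and are absent by inspection.\<close>
lemma power_of_5_between:
  fixes p b E :: nat
  assumes p: "p \<ge> 13" "p mod 4 = 1" and b: "b \<ge> 1"
    and lo: "p ^ Suc b < 2 ^ E" and hi: "2 ^ E < p ^ b * (p + 1)"
  shows "\<exists>a f. a \<ge> 1 \<and> 5 * (p ^ b * (p + 1)) \<le> 6 * (2 ^ a * 5 ^ Suc f) \<and> 2 ^ a * 5 ^ Suc f \<le> p ^ Suc b"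
proof -
  define P Q where "P = p ^ b" and "Q = p * P"
  have Q: "p ^ Suc b = Q" "p ^ b * (p + 1) = Q + P" by (simp_all add: P_def Q_def)
  have PQ: "13 * P \<le> Q" using p(1) by (simp add: Q_def)
  have P0: "P > 0" using p(1) by (simp add: P_def)
  note lo' = lo [unfolded Q] and hi' = hi [unfolded Q]
  have split: "(2::nat) ^ E = 2 ^ c * 2 ^ (E - c)" if "c \<le> E" for c
    using that by (simp flip: power_add)
  have b_less: "b < c" if "Q < 13 ^ Suc c" for c
  proof -
    have "13 ^ Suc b \<le> p ^ Suc b" using p(1) by (rule power_mono) simp
    then have "(13::nat) ^ Suc b < 13 ^ Suc c" using that Q(1) by linarith
    then show ?thesis by (subst (asm) power_strict_increasing_iff) auto
  qed
  have QE: "Q < 2 ^ c" if "E \<le> c" for c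
    using lo' power_increasing [OF that, of "2::nat"] by linarith
  consider "E < 8" | "8 \<le> E" "125 * 2 ^ (E - 7) \<le> Q" | "8 \<le> E" "E < 15" "Q < 125 * 2 ^ (E - 7)"
    | "15 \<le> E" "Q < 125 * 2 ^ (E - 7)" "15625 * 2 ^ (E - 14) \<le> Q" 
    | "15 \<le> E" "E < 22" "Q < 15625 * 2 ^ (E - 14)"
    | "22 \<le> E" "Q < 15625 * 2 ^ (E - 14)" "1953125 * 2 ^ (E - 21) \<le> Q" 
    | "22 \<le> E" "E < 29" "Q < 1953125 * 2 ^ (E - 21)"
    | "29 \<le> E" unfolding linorder_not_less [symmetric] by blast
  then show ?thesis
  proof cases
    case 1
    then have "Q < 2 ^ 7" by (intro QE) simp
    moreover have "13 ^ 2 \<le> p ^ 2" using p(1) by (rule power_mono) simp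
    moreover have "p ^ 2 \<le> p ^ Suc b" using p(1) b by (intro power_increasing) simp_all
    ultimately show ?thesis using Q(1) by simp
  next
    case 2
    have "5 * (Q + P) \<le> 6 * (2 ^ (E - 7) * 5 ^ Suc 2)" using lo' PQ split [of 7] 2(1) by simp
    then show ?thesis unfolding Q using 2 by (intro exI [of _ "E - 7"] exI [of _ 2]) simp
  next
    case 3
    \<comment> \<open>From \<open>125/128 > Q/2\<^sup>E\<close> and \<open>2\<^sup>E < Q + P\<close>, where \<open>128 - 125 = 3\<close>; likewise for the numbers
      \<open>759 = 2\<^sup>1\<^sup>4 - 5\<^sup>6\<close> and \<open>144027 = 2\<^sup>2\<^sup>1 - 5\<^sup>9\<close> further down.\<close>
    have "3 * Q < 125 * P" using 3 hi' split [of 7] by simp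
    then have "3 * p * P < 125 * P" by (simp add: Q_def)
    then have "p \<le> 41" by simp
    then have p': "p \<in> {13,17,21,25,29,33,37,41}" using p by (simp; presburger)
    have "b < 3" by (rule b_less) (use QE [of 14] 3(2) in simp)
    then have b': "b \<in> {1,2}" using b by auto
    have E': "E \<in> {8,9,10,11,12,13,14}" using 3 by auto
    show ?thesis using p' b' E' lo hi by auto
  next
    case 4
    have "5 * (Q + P) \<le> 6 * (2 ^ (E - 14) * 5 ^ Suc 5)" using lo' PQ split [of 14] 4(1) by simp
    then show ?thesis unfolding Q using 4 by (intro exI [of _ "E - 14"] exI [of _ 5]) simp
  next
    case 5
    have "759 * Q < 15625 * P" using 5 hi' split [of 14] by simp
    then have "759 * p * P < 15625 * P" by (simp add: Q_def)
    then have "p \<le> 20" by simp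
    then have p': "p \<in> {13,17}" using p by (simp; presburger)
    have "b < 5" by (rule b_less) (use QE [of 21] 5(2) in simp)
    then have b': "b \<in> {1,2,3,4}" using b by auto
    have E': "E \<in> {15,16,17,18,19,20,21}" using 5 by auto
    show ?thesis using p' b' E' lo hi by auto
  next
    case 6
    have "5 * (Q + P) \<le> 6 * (2 ^ (E - 21) * 5 ^ Suc 8)" using lo' PQ split [of 21] 6(1) by simp
    then show ?thesis unfolding Q using 6 by (intro exI [of _ "E - 21"] exI [of _ 8]) simp
  next
    case 7
    have "144027 * Q < 1953125 * P" using 7 hi' split [of 21] by simp
    then have "144027 * p * P < 1953125 * P" by (simp add: Q_def)
    then have "p \<le> 13" by simp
    then have p': "p = 13" using p by simp
    have "b < 7" by (rule b_less) (use QE [of 28] 7(2) in simp)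
    then have b': "b \<in> {1,2,3,4,5,6}" using b by auto
    have E': "E \<in> {22,23,24,25,26,27,28}" using 7 by auto
    show ?thesis using p' b' E' lo hi 7 Q by auto
  next
    case 8
    have "5 * (Q + P) \<le> 6 * (2 ^ (E - 28) * 5 ^ Suc 11)" "2 ^ (E - 28) * 5 ^ Suc 11 \<le> Q"
      using lo' hi' PQ split [of 28] 8 by simp_all
    then show ?thesis unfolding Q using 8 by (intro exI [of _ "E - 28"] exI [of _ 11]) simp
  qed
qed

lemma smooth_times_power_of_2:
  assumes "m \<ge> 1" "\<And>p. prime p \<Longrightarrow> p dvd m \<Longrightarrow> p dvd k * (k + 1)" "\<not> (9 dvd m \<and> 9 dvd U k 3)"
    and e: "e \<ge> 1"
  shows "m * 2 ^ e \<in> setB k"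
  unfolding setB_iff
proof (intro conjI allI impI notI)
  show "m * 2 ^ e \<ge> 1" using assms(1) by simp
  show "even (m * 2 ^ e)" using e by simp
  fix p :: nat assume p: "prime p" "p dvd m * 2 ^ e"
  then have "p dvd m \<or> p dvd 2" using prime_dvd_mult_iff prime_dvd_power by blast
  moreover have "2 dvd k * (k + 1)" by simp
  ultimately show "p dvd k * (k + 1)" using assms(2) [OF p(1)] dvd_trans by blast
next
  assume a: "9 dvd m * 2 ^ e \<and> 9 dvd U k 3"
  have "\<not> 3 dvd (2::nat)" by simp
  moreover have "prime (3::nat)" by simp
  ultimately have "coprime (3::nat) 2" using prime_imp_coprime by blast
  then have "coprime (3 ^ 2 :: nat) (2 ^ e)" unfolding coprime_power_left_iff coprime_power_right_iff by blast
  moreover have "(3 ^ 2 :: nat) dvd m * 2 ^ e" using a by simp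
  ultimately have "3 ^ 2 dvd m" by (simp only: coprime_dvd_mult_left_iff)
  then show False using a assms(3) by simp
qed

text \<open>Powers of 2 belong to the family for every \<open>k\<close>, so a competitor with \<open>2n \<le> m + 1\<close> never beats the minimum.\<close>
lemma power_of_2_in_setS:
  assumes "n \<ge> 1" "2 * n \<le> m + 1" shows "\<exists>x\<in>setS k n. x \<le> m"
proof (cases "n = 1")
  case True
  have "1 \<in> setA k" by (auto simp: setA_iff)
  then show ?thesis using True assms by (intro bexI [of _ 1]) (auto simp: setS_def)
next
  case False
  then obtain e where e: "2 ^ e < n" "n \<le> 2 ^ Suc e"
    using ex_power_ivl2 [of 2 n] assms(1) by auto
  have "2 ^ Suc e \<in> setB k"
  proof -
    have "\<not> 9 dvd (2::nat) ^ Suc e"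
    proof
      assume "9 dvd (2::nat) ^ Suc e"
      then have "3 dvd (2::nat) ^ Suc e" by (rule dvd_trans [rotated]) simp
      moreover have "prime (3::nat)" by simp
      ultimately have "3 dvd (2::nat)" using prime_dvd_power by blast
      then show False by simp
    qed
    moreover have "p = 2" if "prime p" "p dvd 2 ^ Suc e" for p :: nat
      using that by (metis prime_dvd_power primes_dvd_imp_eq two_is_prime_nat)
    moreover have "2 dvd k * (k + 1)" by simp
    ultimately show ?thesis unfolding setB_iff by (metis dvd_triv_left one_le_numeral one_le_power power_Suc)
  qed
  then show ?thesis using e assms by (intro bexI [of _ "2 ^ Suc e"]) (auto simp: setS_def)
qed

text \<open>The ratios between consecutive elements of 2, 4, 6, 8, 12, 16, 24, ... never exceed \<open>3/2\<close> after 4; the first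
gap, at \<open>n = 3\<close>, still satisfies the bound \<open>5/3\<close>.\<close>
lemma two_three_smooth_in_interval:
  fixes n :: nat
  assumes "n \<ge> 1"
  shows "\<exists>x. n \<le> x \<and> 3 * x \<le> 5 * n \<and> (x = 1 \<or> (\<exists>e\<ge>1. x = 2 ^ e \<or> x = 3 * 2 ^ e))"
proof (cases "n = 1")
  case False
  then obtain e where e: "2 ^ e < n" "n \<le> 2 ^ (e + 1)" using ex_power_ivl2 [of 2 n] assms by auto
  show ?thesis
  proof (cases "e \<ge> 2 \<and> 2 * n \<le> 3 * 2 ^ e")
    case True
    obtain d where d: "e = Suc d" "d \<ge> 1" using True by (cases e) auto
    \<comment> \<open>The bound \<open>9\<cdot>2\<^sup>d \<le> 5n\<close> follows from \<open>n > 2\<^sup>d\<^sup>+\<^sup>1\<close>.\<close>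
    have "n \<le> 3 * 2 ^ d" "3 * (3 * 2 ^ d) \<le> 5 * n" using e(1) True unfolding d(1) by simp_all
    then show ?thesis using d(2) by blast
  next
    case f: False
    have "3 * 2 ^ (e + 1) \<le> 5 * n"
    proof (cases "e \<ge> 2")
      case True
      then show ?thesis using f by simp
    next
      case False
      then have "e = 0 \<or> e = 1" by auto
      then show ?thesis using e by auto
    qed
    moreover have "e + 1 \<ge> 1" by simp
    ultimately show ?thesis using e(2) by blast
  qed
next
  case True
  then have "n \<le> 1" "3 * 1 \<le> 5 * n" by simp_all
  then show ?thesis by blast
qed

lemma two_three_smooth_in_setS:
  assumes "n \<ge> 1" "3 dvd k * (k + 1)" "5 * n \<le> 3 * m"
  shows "\<exists>x\<in>setS k n. x \<le> m"
proof -
  obtain x where x: "n \<le> x" "3 * x \<le> 5 * n" and shape: "x = 1 \<or> (\<exists>e\<ge>1. x = 2 ^ e \<or> x = 3 * 2 ^ e)"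
    using two_three_smooth_in_interval [OF assms(1)] by blast
  have three: "p = 3" if "prime p" "p dvd 3" for p :: nat
  proof -
    have "prime (3::nat)" by simp
    then show ?thesis using that primes_dvd_imp_eq by blast
  qed
  have "x \<in> setA k \<union> setB k" using shape
  proof (elim disjE exE conjE)
    assume "x = 1"
    then show ?thesis by (auto simp: setA_iff)
  next
    fix e :: nat assume "e \<ge> 1" "x = 2 ^ e"
    then show ?thesis using smooth_times_power_of_2 [of 1 k e] by simp
  next
    fix e :: nat assume "e \<ge> 1" "x = 3 * 2 ^ e"
    then show ?thesis using smooth_times_power_of_2 [of 3 k e] three assms(2) by auto
  qed
  then show ?thesis using x assms(3) by (intro bexI [of _ x]) (auto simp: setS_def)
qed

section \<open>Ranks of appearance of composite moduli\<close>

lemma rank_mult: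
  assumes "int a dvd U k s" "int c dvd U k t" "coprime a c"
  shows "int (a * c) dvd U k (s * t)"
  using assms dvd_U_mult by (simp add: divides_mult)

lemma split_off_prime_power:
  fixes m :: nat
  assumes "m \<ge> 1" "prime p" "p dvd m"
  obtains b y where "m = p ^ Suc b * y" "\<not> p dvd y" "coprime (p ^ Suc b) y" "y \<ge> 1"
proof -
  have "m \<noteq> 0" "\<not> is_unit p" using assms by auto
  then obtain y where y: "m = p ^ multiplicity p m * y" "\<not> p dvd y" by (rule multiplicity_decompose')
  then obtain b where "multiplicity p m = Suc b" using assms(3) by (cases "multiplicity p m") auto
  then have "m = p ^ Suc b * y" using y(1) by simp
  moreover have "coprime (p ^ Suc b) y"
    unfolding coprime_power_left_iff using prime_imp_coprime [OF assms(2) y(2)] by simp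
  moreover have "y \<ge> 1" using \<open>m \<noteq> 0\<close> y(1) by (cases y) auto
  ultimately show ?thesis using that y(2) by blast
qed

lemma non_divisor_odd:
  assumes p: "prime p" "\<not> int p dvd pell_D k" shows "odd p" "p \<ge> 3"
proof -
  have "p \<noteq> 2" using p(2) prime_dvd_pell_D_iff [of 2 k] by auto
  then show "odd p" "p \<ge> 3" using p(1) prime_ge_2_nat [OF p(1)] primes_dvd_imp_eq [OF two_is_prime_nat] by auto
qed

lemma prime_power_rank:
  assumes p: "prime p" "\<not> int p dvd pell_D k"
  obtains h where "h \<ge> 1" "2 * h = p - 1 \<or> 2 * h = p + 1" "int p dvd U k h"
    "\<And>b. int (p ^ Suc b) dvd U k (p ^ b * h)"
proof -
  note p2 = non_divisor_odd(1) [OF p]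
  obtain h where h: "int p dvd U k h" "2 * h = p - 1 \<or> 2 * h = p + 1"
    using rank_of_prime [OF p(1) p2 p(2)] by blast
  have "p > 1" using p(1) by (rule prime_gt_1_nat)
  then have "h \<ge> 1" using h(2) p2 by (cases "p = 2") auto
  moreover have "int (p ^ Suc b) dvd U k (p ^ b * h)" for b
    using prime_power_lift [of p 0 k h b] h(1) by simp
  ultimately show ?thesis using that h by blast
qed

text \<open>Primes of \<open>D\<close> contribute rank \<open>p\<^sup>b\<close>, the other primes at most \<open>p\<^sup>b\<^sup>-\<^sup>1 (p+1)/2\<close>, and ranks of coprime moduli multiply
at worst.\<close>
lemma rank_le: "m \<ge> 1 \<Longrightarrow> \<exists>t\<ge>1. t \<le> m \<and> int m dvd U k t"
proof (induction m rule: less_induct)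
  case (less m)
  show ?case
  proof (cases "m = 1")
    case True
    then show ?thesis by (intro exI [of _ 1]) simp
  next
    case False
    then obtain p where p: "prime p" "p dvd m" using prime_factor_nat by blast
    obtain b m' where m: "m = p ^ Suc b * m'" "coprime (p ^ Suc b) m'" and m': "m' \<ge> 1"
      using split_off_prime_power [OF less.prems p] by metis
    have "1 < p ^ Suc b" using prime_gt_1_nat [OF p(1)] by (rule one_less_power) simp
    then have "m' < m" using m(1) m' by simp
    then obtain t where t: "t \<ge> 1" "t \<le> m'" "int m' dvd U k t" using less.IH m' by blast
    have "\<exists>s\<ge>1. s \<le> p ^ Suc b \<and> int (p ^ Suc b) dvd U k s"
    proof (cases "int p dvd pell_D k")
      case True
      have "1 \<le> p ^ Suc b" using \<open>1 < p ^ Suc b\<close> by linarith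
      then show ?thesis using prime_power_dvd_U [OF p(1) True, of "Suc b"] by blast
    next
      case False
      obtain h where h: "h \<ge> 1" "2 * h = p - 1 \<or> 2 * h = p + 1" "int (p ^ Suc b) dvd U k (p ^ b * h)"
        using prime_power_rank [OF p(1) False] by metis
      have "h \<le> p" using h by linarith
      then have "p ^ b * h \<le> p ^ Suc b" by simp
      moreover have "1 \<le> p ^ b * h" using h(1) prime_gt_0_nat [OF p(1)] by (simp add: Suc_le_eq)
      ultimately show ?thesis using h(3) by blast
    qed
    then obtain s where s: "s \<ge> 1" "s \<le> p ^ Suc b" "int (p ^ Suc b) dvd U k s" by blast
    have "int m dvd U k (s * t)" unfolding m(1) by (rule rank_mult [OF s(3) t(3) m(2)])
    moreover have "s * t \<le> m" unfolding m(1) using s t by (intro mult_le_mono)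
    moreover have "s * t \<ge> 1" using s t by simp
    ultimately show ?thesis by blast
  qed
qed

lemma discriminates_pos: "discriminates k m n \<Longrightarrow> m \<ge> 1" by (simp add: discriminates_def)

text \<open>In the exceptional residue classes the index loses a factor 3 against the modulus.\<close>
lemma rank_of_nine:
  assumes d: "discriminates k m n" and 9: "9 dvd m" "9 dvd U k 3"
  shows "2 * n \<le> m"
proof -
  have m1: "m \<ge> 1" using discriminates_pos [OF d] .
  have "prime (3::nat)" "3 dvd m" using 9(1) by (simp, presburger)
  then obtain c y where c: "m = 3 ^ Suc c * y" "\<not> 3 dvd y" "coprime (3 ^ Suc c) y" "y \<ge> 1"
    using split_off_prime_power [OF m1] by metis
  have "c \<noteq> 0"
  proof
    assume "c = 0"
    then have "3 * 3 dvd 3 * y" using 9(1) c(1) by simp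
    then show False using c(2) by presburger
  qed
  then obtain b where b: "c = 1 + b" by (cases c) auto
  note m = c(1) [unfolded b]
  obtain t where t: "t \<ge> 1" "t \<le> y" "int y dvd U k t" using rank_le [OF c(4)] by blast
  have "int 3 ^ Suc 1 dvd U k 3" using 9(2) by simp
  then have "int (3 ^ Suc (1 + b)) dvd U k (3 ^ b * 3)" using prime_power_lift [of 3 1 k 3 b] by simp
  then have "int m dvd U k ((3 ^ b * 3) * t)" unfolding m using t(3) c(3) [unfolded b] rank_mult by blast
  moreover have "(3 ^ b * 3) * t > 0" using t(1) by simp
  ultimately have "n \<le> (3 ^ b * 3) * t" using discriminates_le_rank [OF d] by blast
  also have "\<dots> \<le> (3 ^ b * 3) * y" using t(2) by simp
  finally show ?thesis using m by simp
qed

text \<open>Two primes \<open>p \<noteq> q\<close> outside \<open>D\<close> contribute the factor \<open>(p+1)(q+1)/(4pq)\<close>, at most \<open>(4\<cdot>5)/(4\<cdot>3\<cdot>4) < 1/2\<close>.\<close>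
lemma two_non_divisors:
  assumes d: "discriminates k m n" and p: "prime p" "\<not> int p dvd pell_D k" and m: "m = p ^ Suc b * m'" "\<not> p dvd m'"
    and q: "prime q" "\<not> int q dvd pell_D k" "q dvd m'"
  shows "2 * n \<le> m"
proof -
  have m1: "m \<ge> 1" using discriminates_pos [OF d] .
  then have "m' \<ge> 1" using m(1) by (cases m') auto
  then obtain c y where m': "m' = q ^ Suc c * y" "coprime (q ^ Suc c) y" and y1: "y \<ge> 1"
    using split_off_prime_power [OF _ q(1,3)] by metis
  obtain t where t: "t \<ge> 1" "t \<le> y" "int y dvd U k t" using rank_le [OF y1] by blast
  obtain h where h: "h \<ge> 1" "2 * h = p - 1 \<or> 2 * h = p + 1" "int (p ^ Suc b) dvd U k (p ^ b * h)"
    using prime_power_rank [OF p] by metis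
  obtain g where g: "g \<ge> 1" "2 * g = q - 1 \<or> 2 * g = q + 1" "int (q ^ Suc c) dvd U k (q ^ c * g)"
    using prime_power_rank [OF q(1,2)] by metis
  have "int m' dvd U k (q ^ c * g * t)" unfolding m'(1) using g(3) t(3) m'(2) rank_mult by blast
  moreover have "coprime (p ^ Suc b) m'"
    unfolding coprime_power_left_iff using prime_imp_coprime [OF p(1) m(2)] by simp
  ultimately have "int m dvd U k (p ^ b * h * (q ^ c * g * t))" unfolding m(1) using h(3) rank_mult by blast
  moreover have "p ^ b * h * (q ^ c * g * t) > 0" using h(1) g(1) t(1) p(1) q(1) by (auto simp: prime_gt_0_nat)
  ultimately have n: "n \<le> p ^ b * h * (q ^ c * g * t)" using discriminates_le_rank [OF d] by blast
  have "p \<noteq> q" using q(3) m(2) by blast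
  then have "p \<ge> 4 \<and> q \<ge> 3 \<or> p \<ge> 3 \<and> q \<ge> 4"
    using non_divisor_odd(2) [OF p] non_divisor_odd(2) [OF q(1,2)] by linarith
  then have pq: "(p + 1) * (q + 1) \<le> 2 * (p * q)"
  proof
    assume a: "p \<ge> 4 \<and> q \<ge> 3"
    then obtain u v where "p = u + 4" "q = v + 3" by (metis le_add_diff_inverse2)
    then show ?thesis by (simp add: algebra_simps)
  next
    assume a: "p \<ge> 3 \<and> q \<ge> 4"
    then obtain u v where "p = u + 3" "q = v + 4" by (metis le_add_diff_inverse2)
    then show ?thesis by (simp add: algebra_simps)
  qed
  have "(2 * h) * (2 * g) \<le> (p + 1) * (q + 1)" using h(2) g(2) by (intro mult_le_mono) auto
  then have hg: "2 * (h * g) \<le> p * q" using pq by simp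
  have "2 * n \<le> p ^ b * q ^ c * (2 * (h * g)) * t" using n by (simp add: mult_ac)
  also have "\<dots> \<le> p ^ b * q ^ c * (p * q) * y" by (intro mult_le_mono order_refl hg t(2))
  finally show ?thesis unfolding m(1) m'(1) by (simp add: mult_ac)
qed

section \<open>Moduli composed of divisors of k(k+1)\<close>

lemma split_along_k_and_Suc_k:
  fixes m k :: nat
  shows "m \<ge> 1 \<Longrightarrow> (\<And>p. prime p \<Longrightarrow> p dvd m \<Longrightarrow> p dvd k * (k + 1)) \<Longrightarrow>
   \<exists>a c. m = a * c \<and> (\<forall>p. prime p \<longrightarrow> p dvd a \<longrightarrow> p dvd k) \<and> (\<forall>p. prime p \<longrightarrow> p dvd c \<longrightarrow> p dvd k + 1)"
proof (induction m rule: less_induct)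
  case (less m)
  show ?case
  proof (cases "m = 1")
    case True
    then show ?thesis by (intro exI [of _ 1]) auto
  next
    case False
    then obtain q m' where q: "prime q" "m = q * m'" using prime_factor_nat by (metis dvdE)
    have "m' \<ge> 1" using q(2) less.prems(1) by (cases m') auto
    moreover have "m' < m" using q \<open>m' \<ge> 1\<close> prime_gt_1_nat [OF q(1)] by simp
    moreover have "p dvd k * (k + 1)" if "prime p" "p dvd m'" for p
      using less.prems(2) [OF that(1)] that(2) q(2) by (metis dvd_mult)
    ultimately obtain a c where ac: "m' = a * c" "\<And>p. prime p \<Longrightarrow> p dvd a \<Longrightarrow> p dvd k"
      "\<And>p. prime p \<Longrightarrow> p dvd c \<Longrightarrow> p dvd k + 1" using less.IH [of m'] by blast
    have "q dvd k * (k + 1)" using less.prems(2) [OF q(1)] q(2) by simp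
    then consider "q dvd k" | "q dvd k + 1" using q(1) prime_dvd_mult_iff by blast
    then show ?thesis
    proof cases
      case 1
      have "p dvd k" if "prime p" "p dvd q * a" for p
        using that ac(2) 1 q(1) by (metis prime_dvd_mult_iff primes_dvd_imp_eq)
      then show ?thesis using ac q(2) by (intro exI [of _ "q * a"] exI [of _ c]) (auto simp: mult_ac)
    next
      case 2
      have "p dvd k + 1" if "prime p" "p dvd q * c" for p
        using that ac(3) 2 q(1) by (metis prime_dvd_mult_iff primes_dvd_imp_eq)
      then show ?thesis using ac q(2) by (intro exI [of _ a] exI [of _ "q * c"]) (auto simp: mult_ac)
    qed
  qed
qed

lemma coprime_k_parts:
  fixes a c :: nat
  assumes "\<And>p. prime p \<Longrightarrow> p dvd a \<Longrightarrow> p dvd k" "\<And>p. prime p \<Longrightarrow> p dvd c \<Longrightarrow> p dvd k + 1"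
  shows "coprime a c"
proof -
  have "False" if "prime p" "p dvd a" "int p dvd int c" for p
  proof -
    have "p dvd k" "p dvd k + 1" using assms that by auto
    then have "p dvd 1" by (metis dvd_add_right_iff)
    then show False using that(1) by simp
  qed
  then have "coprime (int a) (int c)" by (rule coprime_int_primeI)
  then show ?thesis by simp
qed

text \<open>With \<open>(N-1)(N'-1) \<ge> 0\<close> in the first case of \<open>collision\<close>, and \<open>N > N' \<ge> 3\<close> in the second, both bounds come out
at most half of \<open>N N' + 1\<close>.\<close>
lemma odd_collision:
  assumes d: "discriminates k (q * q') n" and co: "coprime q q'"
    and per: "period k q N" "odd N" and anti: "antiperiod k q' N'" "odd N'" "N' \<ge> 3"
    and NN: "N * N' \<le> q * q'"
  shows "2 * n \<le> q * q' + 1"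
proof -
  have "N \<ge> 1" using per(2) by (cases N) auto
  then obtain u where u: "N = u + 1" by (metis add.commute le_add_diff_inverse)
  obtain v where v: "N' = v + 3" using anti(3) by (metis add.commute le_add_diff_inverse)
  have NN': "u * v + 3 * u + v + 3 \<le> q * q'" using NN unfolding u v by (simp add: algebra_simps)
  have "2 * n \<le> N + N' \<or> N' < N \<and> n + 1 \<le> N + N'"
    using collision [OF d co per(1) _ anti(1)] per(2) anti(2,3) u by simp
  then show ?thesis using NN' unfolding u v by linarith
qed

text \<open>A modulus composed of primes of \<open>k(k+1)\<close> either belongs to the family or is odd with a nontrivial factor
\<open>c\<close> of primes of \<open>k + 1\<close>; then the antiperiod \<open>c\<close> produces a collision with the period given by the primes of \<open>k\<close>.\<close>
lemma smooth_case:
  assumes d: "discriminates k m n" and sm: "\<And>p. prime p \<Longrightarrow> p dvd m \<Longrightarrow> p dvd k * (k + 1)"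
    and 9: "\<not> (9 dvd m \<and> 9 dvd U k 3)"
  shows "2 * n \<le> m + 1 \<or> m \<in> setS k n"
proof -
  have m1: "m \<ge> 1" using discriminates_pos [OF d] .
  have "int m dvd U k m" using sm m1 prime_dvd_pell_D_iff by (intro dvd_U_self) auto
  then have nm: "n \<le> m" using discriminates_le_rank [OF d] m1 by simp
  show ?thesis
  proof (cases "even m")
    case True
    then have "m \<in> setB k" using m1 sm 9 by (simp add: setB_iff)
    then show ?thesis using nm by (simp add: setS_def)
  next
    case False
    obtain a c where m: "m = a * c" and a: "\<And>p. prime p \<Longrightarrow> p dvd a \<Longrightarrow> p dvd k"
      and c: "\<And>p. prime p \<Longrightarrow> p dvd c \<Longrightarrow> p dvd k + 1"
      using split_along_k_and_Suc_k [OF m1 sm] by blast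
    have ac: "odd a" "odd c" using False m by auto
    show ?thesis
    proof (cases "c = 1")
      case True
      then have "m \<in> setA k" using m m1 False a 9 by (simp add: setA_iff)
      then show ?thesis using nm by (simp add: setS_def)
    next
      case c1: False
      have "c \<ge> 3" using ac(2) c1 by presburger
      then have "2 * n \<le> a * c + 1"
        using d ac a c coprime_k_parts [OF a c] unfolding m
        by (intro odd_collision [of k a c n a c] period_of_dvd_k antiperiod_of_dvd_Suc_k) (auto simp: odd_pos)
      then show ?thesis using m by simp
    qed
  qed
qed

section \<open>Moduli with one prime outside k(k+1)\<close>

text \<open>The situation that remains after the easy reductions: exactly one prime \<open>p\<close> of \<open>m\<close> does not divide
\<open>k(k+1)\<close>, and \<open>y\<close> collects all other prime powers of \<open>m\<close>.\<close>
locale one_prime_outside =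
  fixes k m n p b y :: nat
  assumes disc: "discriminates k m n"
    and p: "prime p" "\<not> int p dvd pell_D k"
    and m: "m = p ^ Suc b * y" and co: "coprime (p ^ Suc b) y"
    and smooth: "\<And>q. prime q \<Longrightarrow> q dvd y \<Longrightarrow> q dvd k * (k + 1)"
    and nine: "\<not> (9 dvd m \<and> 9 dvd U k 3)"
begin

lemma y_pos: "y \<ge> 1" using discriminates_pos [OF disc] m by (cases y) auto

lemma y_dvd_U: "int y dvd U k y"
  using y_pos smooth prime_dvd_pell_D_iff by (intro dvd_U_self) auto

lemma nine_y: "\<not> (9 dvd y \<and> 9 dvd U k 3)"
  using nine m by (metis dvd_mult)

lemma period_y: "period k y (2 * y)"
proof -
  have "T k (2 * y) - 1 = 2 * pell_D k * U k y * U k y"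
    unfolding T_double pell by (simp add: power2_eq_square)
  then show ?thesis using y_dvd_U by (simp add: period_def dvd_U_mult)
qed

lemma power_dvd_U: "int p dvd U k h \<Longrightarrow> int (p ^ Suc b) dvd U k (p ^ b * h)"
  using prime_power_lift [of p 0 k h b] by simp

lemma le_rank:
  assumes "int p dvd U k h" "h \<ge> 1" shows "n \<le> p ^ b * h * y"
proof -
  have "int m dvd U k (p ^ b * h * y)"
    unfolding m by (rule rank_mult [OF power_dvd_U [OF assms(1)] y_dvd_U co])
  moreover have "p ^ b * h * y > 0" using assms(2) y_pos prime_gt_0_nat [OF p(1)] by simp
  ultimately show ?thesis using discriminates_le_rank [OF disc] by blast
qed

text \<open>Either the rank divides \<open>(p-1)/2\<close> and nothing is left to do, or \<open>n\<close> is bounded through \<open>(p+1)/2\<close>.\<close>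
lemma rank_cases:
  "2 * n \<le> m \<or> (\<exists>h. 2 * h = p + 1 \<and> int p dvd U k h \<and> 2 * n \<le> p ^ b * (p + 1) * y)"
proof -
  obtain h where h: "h \<ge> 1" "2 * h = p - 1 \<or> 2 * h = p + 1" "int p dvd U k h"
    using prime_power_rank [OF p] by metis
  have n: "2 * n \<le> p ^ b * (2 * h) * y" using le_rank [OF h(3,1)] by simp
  from h(2) show ?thesis
  proof
    assume "2 * h = p - 1"
    note n
    also have "p ^ b * (2 * h) * y \<le> p ^ b * p * y"
      unfolding \<open>2 * h = p - 1\<close> by (intro mult_le_mono) auto
    finally show ?thesis by (simp add: m mult_ac)
  next
    assume "2 * h = p + 1"
    then show ?thesis using n h(3) by metis
  qed
qed

lemma case_3_dvd:
  assumes "3 dvd k * (k + 1)" shows "5 * n \<le> 3 * m"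
proof -
  have "prime (3::nat)" by simp
  then have "p \<noteq> 3" using assms p(2) prime_dvd_pell_D_iff [of 3 k] by auto
  then have p5: "p \<ge> 5" using non_divisor_odd [OF p] by presburger
  from rank_cases show ?thesis
  proof
    assume "\<exists>h. 2 * h = p + 1 \<and> int p dvd U k h \<and> 2 * n \<le> p ^ b * (p + 1) * y"
    then have "2 * n \<le> p ^ b * (p + 1) * y" by blast
    then have "5 * (2 * n) \<le> 5 * (p ^ b * (p + 1) * y)" by (rule mult_le_mono2)
    also have "\<dots> = p ^ b * (5 * (p + 1)) * y" by (simp only: mult_ac)
    also have "\<dots> \<le> p ^ b * (6 * p) * y" using p5 by (intro mult_le_mono1 mult_le_mono2) simp
    finally show ?thesis by (simp add: m mult_ac)
  qed simp
qed

text \<open>If \<open>2\<^sup>e\<close> is the largest power of 2 below \<open>p\<close>, then \<open>p + 1 \<le> 2\<^sup>e\<^sup>+\<^sup>1\<close>, so already \<open>2\<^sup>e y < m\<close> separates \<open>n\<close> terms.\<close>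
lemma case_first_power:
  assumes "b = 0" shows "2 * n \<le> m \<or> (\<exists>x\<in>setS k n. x \<le> m)"
proof -
  obtain e where e: "2 ^ e \<le> p" "p < 2 ^ (e + 1)"
    using ex_power_ivl1 [of 2 p] prime_ge_1_nat [OF p(1)] by auto
  have "e \<ge> 1" using e non_divisor_odd(2) [OF p] by (cases e) auto
  then have B: "y * 2 ^ e \<in> setB k" using y_pos smooth nine_y by (intro smooth_times_power_of_2) auto
  from rank_cases show ?thesis
  proof
    assume "\<exists>h. 2 * h = p + 1 \<and> int p dvd U k h \<and> 2 * n \<le> p ^ b * (p + 1) * y"
    then have "2 * n \<le> (p + 1) * y" using assms by auto
    also have "\<dots> \<le> 2 ^ (e + 1) * y" using e by (intro mult_le_mono) auto
    finally have "n \<le> y * 2 ^ e" by (simp add: mult_ac)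
    moreover have "y * 2 ^ e \<le> m" using e(1) assms by (simp add: m mult_ac)
    ultimately show ?thesis using B by (auto simp: setS_def)
  qed simp
qed

text \<open>Now \<open>h = (p+1)/2\<close> is even. For even \<open>y\<close> the indices \<open>p\<^sup>b h\<close> and \<open>y\<close> share the factor 2. For odd \<open>y\<close>, either the
rank divides \<open>h/2\<close>, or \<open>T\<^sub>h \<equiv> -1\<close> modulo \<open>p\<close> and the even antiperiod \<open>p\<^sup>b h\<close> of \<open>p\<^sup>b\<^sup>+\<^sup>1\<close> collides with the even
period \<open>2y\<close> of \<open>y\<close>. The assumption \<open>b \<ge> 1\<close> is essential: \<open>3y\<close> with \<open>y\<close> composed of primes of \<open>k\<close> has no such
collision.\<close>
lemma case_3_mod_4:
  assumes p4: "p mod 4 = 3" and b: "b \<ge> 1"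
  shows "2 * n \<le> m + 1"
  using rank_cases
proof
  assume "\<exists>h. 2 * h = p + 1 \<and> int p dvd U k h \<and> 2 * n \<le> p ^ b * (p + 1) * y"
  then obtain h where h: "2 * h = p + 1" "int p dvd U k h" by blast
  have "even h" using h(1) p4 by presburger
  then obtain g where g: "h = 2 * g" by blast
  have hp: "h \<le> p" using h(1) non_divisor_odd(2) [OF p] by linarith
  have half: "2 * n \<le> m" if "n \<le> p ^ b * g * y"
  proof -
    have "2 * n \<le> p ^ b * h * y" using that by (simp add: g)
    also have "\<dots> \<le> p ^ b * p * y" using hp by (intro mult_le_mono) auto
    finally show ?thesis by (simp add: m mult_ac)
  qed
  have g1: "g \<ge> 1" using h(1) g by (cases g) auto
  show ?thesis
  proof (cases "even y")
    case True
    then obtain z where z: "y = 2 * z" by blast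
    have "int (p ^ Suc b) dvd U k (z * (p ^ b * h))" using power_dvd_U [OF h(2)] dvd_U_mult by blast
    then have "int (p ^ Suc b) dvd U k (p ^ b * g * y)" by (simp add: z g mult_ac)
    moreover have "int y dvd U k (p ^ b * g * y)" using y_dvd_U dvd_U_mult by blast
    ultimately have "int m dvd U k (p ^ b * g * y)" unfolding m using co by (simp add: divides_mult)
    moreover have "p ^ b * g * y > 0" using g1 y_pos prime_gt_0_nat [OF p(1)] by simp
    ultimately show ?thesis using discriminates_le_rank [OF disc] half by simp
  next
    case False
    have ip: "prime (int p)" using p(1) by simp
    have "int p dvd (T k h - 1) * (T k h + 1)" unfolding pell_factor using h(2) by (simp add: power2_eq_square)
    then consider "int p dvd T k h - 1" | "int p dvd T k h + 1" using ip prime_dvd_mult_iff by blast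
    then show ?thesis
    proof cases
      case 1
      have "T k h - 1 = 2 * pell_D k * U k g ^ 2" unfolding g T_double pell by simp
      then have "int p dvd 2 * pell_D k * U k g ^ 2" using 1 by simp
      moreover have "\<not> int p dvd 2" using non_divisor_odd(2) [OF p] zdvd_imp_le by fastforce
      ultimately have "int p dvd U k g" using p(2) ip by (simp add: prime_dvd_mult_iff prime_dvd_power_iff)
      then show ?thesis using le_rank [OF _ g1] half by simp
    next
      case 2
      define P where "P = p ^ b"
      have "antiperiod k p h" using h(2) 2 by (simp add: antiperiod_def)
      moreover have oddp: "odd p" using non_divisor_odd(1) [OF p] .
      ultimately have ap: "antiperiod k p (P * h)" unfolding P_def by (intro antiperiod_mult) auto
      have "antiperiod k (p ^ Suc b) (P * h)"
      proof (rule antiperiodI)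
        show "int (p ^ Suc b) dvd U k (P * h)" unfolding P_def by (rule power_dvd_U [OF h(2)])
        fix q assume "prime q" "q dvd p ^ Suc b"
        then have "q = p" using p(1) by (metis prime_dvd_power primes_dvd_imp_eq)
        then show "odd q \<and> int q dvd T k (P * h) + 1" using ap oddp by (simp add: antiperiod_def)
      qed
      moreover have "coprime y (p ^ Suc b)" using co by (simp add: coprime_commute)
      moreover have "discriminates k (y * p ^ Suc b) n" using disc by (simp add: m mult_ac)
      moreover have "P > 0" using prime_gt_0_nat [OF p(1)] by (simp add: P_def)
      ultimately have col: "2 * n \<le> 2 * y + P * h \<or> P * h < 2 * y \<and> n + 1 \<le> 2 * y + P * h"
        using period_y y_pos g1 g by (intro collision [of k y "p ^ Suc b"]) auto
      have mP: "m = P * p * y" by (simp add: m P_def mult_ac)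
      have "P \<ge> p" using b prime_ge_1_nat [OF p(1)] power_increasing [of 1 b p] by (simp add: P_def)
      then have P3: "P \<ge> 3" using non_divisor_odd(2) [OF p] by simp
      have Pp: "P * p \<ge> 9" using mult_le_mono [OF P3 non_divisor_odd(2) [OF p]] by simp
      have y9: "9 * y \<le> m" unfolding mP using Pp by (intro mult_le_mono) auto
      from col show ?thesis
      proof
        assume "P * h < 2 * y \<and> n + 1 \<le> 2 * y + P * h"
        then show ?thesis using y9 by linarith
      next
        assume a: "2 * n \<le> 2 * y + P * h"
        have "3 * (2 * h) \<le> 4 * p" using h(1) non_divisor_odd(2) [OF p] by linarith
        then have "P * (3 * (2 * h)) \<le> P * (4 * p)" by (rule mult_le_mono2)
        then have Ph: "3 * (P * h) \<le> 2 * (P * p)" by simp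
        have Pm: "P * p \<le> m" unfolding mP using y_pos by simp
        obtain x where x: "y = x + 1" using y_pos by (metis add.commute le_add_diff_inverse)
        have "P * p * x \<ge> 9 * x" using Pp by (rule mult_le_mono1)
        then have "P * p + 9 * x \<le> m" unfolding mP x by (simp add: algebra_simps)
        moreover have "2 * n \<le> M + 1" if "2 * n \<le> 2 * (x + 1) + A" "3 * A \<le> 2 * B" "9 \<le> B" "B + 9 * x \<le> M"
          for A B M :: nat
          using that by simp
        ultimately show ?thesis using a Ph Pp unfolding x by blast
      qed
    qed
  qed
qed simp

text \<open>If \<open>p\<^sup>b(p+1) \<le> 2\<^sup>e\<^sup>+\<^sup>1\<close> then \<open>2\<^sup>e y\<close> is good enough, as for \<open>b = 0\<close>. Otherwise \<open>p\<^sup>b\<^sup>+\<^sup>1\<close> is so close to the next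
power of 2 that a number \<open>2\<^sup>a 5\<^sup>f\<^sup>+\<^sup>1\<close> fits below it.\<close>
lemma case_1_mod_4:
  assumes p4: "p mod 4 = 1" and p13: "p \<ge> 13" and b: "b \<ge> 1"
  shows "2 * n \<le> m \<or> (\<exists>x\<in>setS k n. x \<le> m) \<or>
    (\<exists>a f. y * 2 ^ a \<in> setB k \<and> 5 * n \<le> 3 * (y * 2 ^ a * 5 ^ Suc f) \<and> y * 2 ^ a * 5 ^ Suc f \<le> m)"
  using rank_cases
proof
  assume "\<exists>h. 2 * h = p + 1 \<and> int p dvd U k h \<and> 2 * n \<le> p ^ b * (p + 1) * y"
  then have n: "2 * n \<le> p ^ b * (p + 1) * y" by blast
  have "p ^ Suc b \<ge> 1" using p13 by simp
  then obtain e where e: "2 ^ e \<le> p ^ Suc b" "p ^ Suc b < 2 ^ (e + 1)"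
    using ex_power_ivl1 [of 2 "p ^ Suc b"] by auto
  have B: "y * 2 ^ a \<in> setB k" if "a \<ge> 1" for a
    using y_pos smooth nine_y that by (intro smooth_times_power_of_2) auto
  show ?thesis
  proof (cases "2 ^ (e + 1) < p ^ b * (p + 1)")
    case True
    then obtain a f where af: "a \<ge> 1" "5 * (p ^ b * (p + 1)) \<le> 6 * (2 ^ a * 5 ^ Suc f)" "2 ^ a * 5 ^ Suc f \<le> p ^ Suc b"
      using power_of_5_between [OF p13 p4 b e(2)] by blast
    have "5 * (2 * n) \<le> 5 * (p ^ b * (p + 1)) * y" using mult_le_mono2 [OF n, of 5] by (simp only: mult.assoc)
    also have "\<dots> \<le> 6 * (2 ^ a * 5 ^ Suc f) * y" using af(2) by (rule mult_le_mono1)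
    finally have "5 * n \<le> 3 * (y * 2 ^ a * 5 ^ Suc f)" by (simp add: mult_ac)
    moreover have "y * 2 ^ a * 5 ^ Suc f \<le> m"
      using mult_le_mono2 [OF af(3), of y] by (simp add: m mult_ac)
    ultimately show ?thesis using B [OF af(1)] by blast
  next
    case False
    note n
    also have "p ^ b * (p + 1) * y \<le> 2 ^ (e + 1) * y" using False by (intro mult_le_mono1) simp
    finally have "n \<le> y * 2 ^ e" by (simp add: mult_ac)
    moreover have "y * 2 ^ e \<le> m" using mult_le_mono2 [OF e(1), of y] by (simp add: m mult_ac)
    moreover have "e \<ge> 1"
    proof (cases e)
      case 0
      have "p ^ 1 \<le> p ^ Suc b" using p13 by (intro power_increasing) simp_all
      moreover have "p ^ Suc b < 2" using e(2) 0 by simp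
      ultimately have "p < 2" by (simp only: power_one_right)
      then show ?thesis using p13 by simp
    qed simp
    ultimately show ?thesis using B by (auto simp: setS_def)
  qed
qed simp

text \<open>For odd \<open>y = ac\<close> the powers of 5 join the period of \<open>a\<close> when \<open>k \<equiv> 3 (mod 5)\<close> and the antiperiod of \<open>c\<close> when
\<open>k \<equiv> 1 (mod 5)\<close>. A collision is avoided only if the resulting antiperiod is trivial, which requires
\<open>k \<equiv> 3 (mod 5)\<close> and \<open>c = 1\<close>.\<close>
lemma case_5:
  assumes p5: "p = 5" and k: "[k = 1] (mod 3)" "[k = 1] (mod 5) \<or> [k = 3] (mod 5)"
  shows "2 * n \<le> m + 1 \<or> (y \<in> setB k \<or> y \<in> setA k \<and> [k = 3] (mod 5)) \<and> 5 * n \<le> 3 * m"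
proof -
  have U3: "int p dvd U k 3" using U_T_mod_5(1) [OF k(2)] p5 by simp
  have n: "5 * n \<le> 3 * m" using le_rank [OF U3] by (simp add: m p5 mult_ac)
  show ?thesis
  proof (cases "even y")
    case True
    then have "y \<in> setB k" using y_pos smooth nine_y by (simp add: setB_iff)
    then show ?thesis using n by blast
  next
    case False
    define P where "P = (5::nat) ^ Suc b"
    define R where "R = 5 ^ b * (3::nat)"
    have pow: "int P dvd U k R" using power_dvd_U [OF U3] by (simp add: P_def R_def p5)
    have RP: "R \<le> P" "odd R" "R \<ge> 3" by (simp_all add: P_def R_def)
    have only5: "q = 5" if "prime q" "q dvd P" for q
    proof -
      have "prime (5::nat)" by simp
      then show ?thesis using that unfolding P_def by (metis prime_dvd_power primes_dvd_imp_eq)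
    qed
    obtain a c where y: "y = a * c" and a: "\<And>p. prime p \<Longrightarrow> p dvd a \<Longrightarrow> p dvd k"
      and c: "\<And>p. prime p \<Longrightarrow> p dvd c \<Longrightarrow> p dvd k + 1"
      using split_along_k_and_Suc_k [OF y_pos smooth] by blast
    have ac: "odd a" "odd c" using False y by auto
    have cop: "coprime a c" using coprime_k_parts [OF a c] by blast
    have cop5: "coprime a P" "coprime c P" using co unfolding y P_def p5 by (simp_all add: coprime_commute)
    have pa: "period k a a" using ac a by (intro period_of_dvd_k) (auto simp: odd_pos)
    have pc: "antiperiod k c c" using ac c by (intro antiperiod_of_dvd_Suc_k) (auto simp: odd_pos)
    have m': "m = P * (a * c)" by (simp add: m y P_def p5)
    from k(2) show ?thesis
    proof
      assume k1: "[k = 1] (mod 5)"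
      then have "antiperiod k 5 3" using U_T_mod_5(1,4) [OF k(2)] by (simp add: antiperiod_def)
      then have a5: "antiperiod k 5 R" unfolding R_def by (intro antiperiod_mult) auto
      have "antiperiod k P R"
      proof (rule antiperiodI [OF pow])
        fix q assume "prime q" "q dvd P"
        then have "q = 5" by (rule only5)
        then show "odd q \<and> int q dvd T k R + 1" using a5 by (simp add: antiperiod_def)
      qed
      then have cR: "antiperiod k (c * P) (c * R)"
        using pc cop5(2) ac(2) RP(2) by (intro antiperiod_coprime_mult) auto
      have "2 * n \<le> a * (c * P) + 1"
      proof (rule odd_collision [OF _ _ pa ac(1) cR])
        show "discriminates k (a * (c * P)) n" using disc by (simp add: m' mult_ac)
        show "coprime a (c * P)" using cop cop5(1) by simp
        show "odd (c * R)" using ac(2) RP(2) by simp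
        show "3 \<le> c * R" using mult_le_mono [of 1 c 3 R] RP(3) ac(2) by (simp add: odd_pos Suc_leI)
        show "a * (c * R) \<le> a * (c * P)" using RP(1) by simp
      qed
      then show ?thesis by (simp add: m' mult_ac)
    next
      assume k3: "[k = 3] (mod 5)"
      show ?thesis
      proof (cases "c = 1")
        case True
        then have "y \<in> setA k" using y y_pos False a nine_y by (simp add: setA_iff)
        then show ?thesis using n k3 by blast
      next
        case c1: False
        have c3: "c \<ge> 3" using ac(2) c1 by presburger
        have "period k 5 3" using U_T_mod_5(1,5) [OF k(2)] k3 by (simp add: period_def)
        then have a5: "period k 5 R" unfolding R_def by (rule period_mult)
        have "period k P R"
        proof (rule periodI [OF pow])
          fix q assume "prime q" "q dvd P"
          then have "q = 5" by (rule only5)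
          then show "odd q \<and> int q dvd T k R - 1" using a5 by (simp add: period_def)
        qed
        then have aR: "period k (a * P) (a * R)" using pa cop5(1) by (intro period_coprime_mult)
        have "2 * n \<le> (a * P) * c + 1"
        proof (rule odd_collision [OF _ _ aR _ pc ac(2) c3])
          show "discriminates k (a * P * c) n" using disc by (simp add: m' mult_ac)
          show "coprime (a * P) c" using cop cop5(2) by (simp add: coprime_commute)
          show "odd (a * R)" using ac(1) RP(2) by simp
          show "a * R * c \<le> a * P * c" using RP(1) by simp
        qed
        then show ?thesis by (simp add: m' mult_ac)
      qed
    qed
  qed
qed

end

section \<open>The discriminator as a minimum\<close>

text \<open>The two exceptional families of the theorem in one: for \<open>k \<equiv> 1 (mod 5)\<close> only the multiples of elements
of \<open>\<B>\<^sub>k\<close> remain.\<close>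
definition times_5_targets :: "nat \<Rightarrow> nat \<Rightarrow> nat set" where
  "times_5_targets k n = {a * 5 ^ Suc b | a b. (a \<in> setB k \<or> a \<in> setA k \<and> [k = 3] (mod 5))
     \<and> 5 * n \<le> 3 * (a * 5 ^ Suc b)}"

definition targets :: "nat \<Rightarrow> nat \<Rightarrow> nat set" where
  "targets k n = setS k n \<union>
     (if [k = 1] (mod 3) \<and> ([k = 1] (mod 5) \<or> [k = 3] (mod 5)) then times_5_targets k n else {})"

text \<open>Besides assembling the cases, one point remains: if 5 divides \<open>k(k+1)\<close>, the numbers \<open>y 2\<^sup>a 5\<^sup>f\<close> belong to \<open>\<B>\<^sub>k\<close>;
otherwise 5 has rank 3 and they are exceptional moduli. The residue \<open>k \<equiv> 2 (mod 5)\<close> is left out because 5 has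
rank 2 there and neither happens.\<close>
lemma target_le_discriminating:
  assumes n: "n \<ge> 1" and d: "discriminates k m n" and k: "[k = 1] (mod 3) \<Longrightarrow> \<not> [k = 2] (mod 5)"
  shows "\<exists>x\<in>targets k n. x \<le> m"
proof -
  have small: ?thesis if "2 * n \<le> m + 1"
    using power_of_2_in_setS [OF n that] unfolding targets_def by blast
  have inS: ?thesis if "\<exists>x\<in>setS k n. x \<le> m" using that unfolding targets_def by blast
  have m1: "m \<ge> 1" using discriminates_pos [OF d] .
  show ?thesis
  proof (cases "9 dvd m \<and> 9 dvd U k 3")
    case True
    then show ?thesis using rank_of_nine [OF d] small by simp
  next
    case 9: False
    show ?thesis
    proof (cases "\<forall>p. prime p \<longrightarrow> p dvd m \<longrightarrow> p dvd k * (k + 1)")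
      case True
      then show ?thesis using smooth_case [OF d _ 9] small inS by blast
    next
      case False
      then obtain p where pm: "prime p" "p dvd m" "\<not> int p dvd pell_D k" using prime_dvd_pell_D_iff by blast
      obtain b y where y: "m = p ^ Suc b * y" "\<not> p dvd y" "coprime (p ^ Suc b) y" "y \<ge> 1"
        using split_off_prime_power [OF m1 pm(1,2)] by metis
      show ?thesis
      proof (cases "\<forall>q. prime q \<longrightarrow> q dvd y \<longrightarrow> q dvd k * (k + 1)")
        case False
        then obtain q where "prime q" "q dvd y" "\<not> int q dvd pell_D k" using prime_dvd_pell_D_iff by blast
        then have "2 * n \<le> m" using two_non_divisors [OF d pm(1,3) y(1,2)] by blast
        then show ?thesis using small by simp
      next
        case True
        interpret one_prime_outside k m n p b y
          by unfold_locales (use d pm y 9 True in auto)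
        show ?thesis
        proof (cases "[k = 1] (mod 3)")
          case False
          then have "k mod 3 = 0 \<or> k mod 3 = 2" unfolding cong_def by (simp; presburger)
          then have "3 dvd k \<or> 3 dvd k + 1" by presburger
          then have "3 dvd k * (k + 1)" using dvd_mult dvd_mult2 by blast
          then show ?thesis using two_three_smooth_in_setS [OF n] case_3_dvd inS by blast
        next
          case k3: True
          have p_odd: "odd p" using non_divisor_odd(1) [OF pm(1,3)] .
          have k5: "[k = 1] (mod 5) \<or> [k = 3] (mod 5)" if "\<not> 5 dvd k * (k + 1)"
          proof -
            have "\<not> 5 dvd k" "\<not> 5 dvd k + 1" using that dvd_mult dvd_mult2 by blast+
            moreover have "k mod 5 \<noteq> 2" using k [OF k3] by (simp add: cong_def)
            ultimately have "k mod 5 = 1 \<or> k mod 5 = 3" by presburger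
            then show ?thesis by (simp add: cong_def)
          qed
          show ?thesis
          proof (cases "p = 5")
            case True
            have "prime (5::nat)" by simp
            then have 5: "[k = 1] (mod 5) \<or> [k = 3] (mod 5)" using k5 pm(3) prime_dvd_pell_D_iff [of 5 k] True by simp
            from case_5 [OF True k3 5] show ?thesis
            proof
              assume "(y \<in> setB k \<or> y \<in> setA k \<and> [k = 3] (mod 5)) \<and> 5 * n \<le> 3 * m"
              moreover have "m = y * 5 ^ Suc b" using y(1) True by (simp add: mult_ac)
              ultimately have "m \<in> times_5_targets k n" unfolding times_5_targets_def by blast
              then show ?thesis using k3 5 unfolding targets_def by auto
            qed (rule small)
          next
            case False
            have "p mod 4 = 3 \<or> p mod 4 = 1" using p_odd by presburger
            then consider "b = 0" | "b \<ge> 1" "p mod 4 = 3" | "b \<ge> 1" "p mod 4 = 1" by (cases "b = 0") auto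
            then show ?thesis
            proof cases
              case 1
              then show ?thesis using case_first_power small inS by fastforce
            next
              case 2
              then show ?thesis using case_3_mod_4 small by blast
            next
              case 3
              have "p \<noteq> 9"
              proof
                assume "p = 9"
                moreover have "prime (3::nat)" by simp
                ultimately show False using pm(1) primes_dvd_imp_eq [of 3 9] by simp
              qed
              then have "p \<ge> 13" using 3(2) False prime_ge_2_nat [OF pm(1)] by presburger
              from case_1_mod_4 [OF 3(2) this 3(1)] show ?thesis
              proof (elim disjE)
                assume "\<exists>a f. y * 2 ^ a \<in> setB k \<and> 5 * n \<le> 3 * (y * 2 ^ a * 5 ^ Suc f) \<and> y * 2 ^ a * 5 ^ Suc f \<le> m"
                then obtain a f where af: "y * 2 ^ a \<in> setB k" "5 * n \<le> 3 * (y * 2 ^ a * 5 ^ Suc f)"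
                  "y * 2 ^ a * 5 ^ Suc f \<le> m" by blast
                show ?thesis
                proof (cases "5 dvd k * (k + 1)")
                  case True
                  define x where "x = y * 2 ^ a * 5 ^ Suc f"
                  have pr: "prime (5::nat)" "prime (3::nat)" by simp_all
                  have "q dvd k * (k + 1)" if "prime q" "q dvd x" for q
                  proof -
                    have "q dvd y * 2 ^ a \<or> q dvd 5"
                      using that prime_dvd_mult_iff prime_dvd_power unfolding x_def by blast
                    then show ?thesis using af(1) that(1) True unfolding setB_iff by (metis dvd_trans)
                  qed
                  moreover have "\<not> 9 dvd U k 3"
                    unfolding nine_dvd_U_3 using k3 by (auto simp: cong_def) presburger+
                  moreover have "x \<ge> 1" "even x" using af(1) by (auto simp: setB_iff x_def)
                  ultimately have "x \<in> setB k" by (simp add: setB_iff)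
                  moreover have "n \<le> x" using af(2) by (simp add: x_def)
                  ultimately show ?thesis using af(3) unfolding x_def [symmetric] by (intro inS) (auto simp: setS_def)
                next
                  case False
                  have "y * 2 ^ a * 5 ^ Suc f \<in> times_5_targets k n"
                    unfolding times_5_targets_def using af by blast
                  then show ?thesis using k3 k5 [OF False] af(3) unfolding targets_def by auto
                qed
              qed (use small inS in auto)
            qed
          qed
        qed
      qed
    qed
  qed
qed

lemma target_discriminates:
  assumes x: "x \<in> targets k n" and 25: "[k = 1] (mod 3) \<Longrightarrow> \<not> [k = 6] (mod 25) \<and> \<not> [k = 18] (mod 25)"
  shows "discriminates k x n"
proof (cases "x \<in> setS k n")
  case True
  then show ?thesis using discriminates_setA discriminates_setB by (auto simp: setS_def)
next
  case False
  then have "[k = 1] (mod 3) \<and> ([k = 1] (mod 5) \<or> [k = 3] (mod 5)) \<and> x \<in> times_5_targets k n"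
    using x by (auto simp: targets_def split: if_splits)
  then show ?thesis
    using discriminates_times_5_power 25 twentyfive_dvd_U_3 by (auto simp: times_5_targets_def simp del: power_Suc)
qed

lemma discriminator_eq_Least_targets:
  assumes n: "n \<ge> 1" and k: "[k = 1] (mod 3) \<Longrightarrow> \<not> [k = 2] (mod 5) \<and> \<not> [k = 6] (mod 25) \<and> \<not> [k = 18] (mod 25)"
  shows "discriminator k n = (LEAST m. m \<in> targets k n)"
proof -
  have disc: "discriminator k n = (LEAST m. discriminates k m n)"
    unfolding discriminator_def discriminates_def ..
  obtain x where "x \<in> targets k n"
    using power_of_2_in_setS [OF n, of "2 * n" k] unfolding targets_def by auto
  then have "(LEAST m. m \<in> targets k n) \<in> targets k n" by (rule LeastI)
  then show ?thesis unfolding disc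
  proof (intro Least_equality target_discriminates)
    fix m assume "discriminates k m n"
    then obtain x where "x \<in> targets k n" "x \<le> m" using target_le_discriminating [OF n] k by blast
    then show "(LEAST m. m \<in> targets k n) \<le> m" by (meson Least_le le_trans)
  qed (use k in auto)
qed

section \<open>Products of powers of 2 and p in short intervals\<close>

lemma first_power_exceeding:
  fixes y :: real
  assumes "1 < y" "y \<le> 6 / 5"
  obtains j where "j \<ge> 1" "6 / 5 < y ^ j" "y ^ j \<le> 36 / 25"
proof -
  define j where "j = (LEAST j. 6 / 5 < y ^ j)"
  obtain i where "6 / 5 < y ^ i" using real_arch_pow [OF assms(1)] by blast
  then have j: "6 / 5 < y ^ j" unfolding j_def by (rule LeastI)
  then obtain l where l: "j = Suc l" by (cases j) auto
  have "\<not> 6 / 5 < y ^ l" using not_less_Least [of l "\<lambda>j. 6 / 5 < y ^ j"] l unfolding j_def by simp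
  then have "y * y ^ l \<le> (6 / 5) * (6 / 5)" using assms by (intro mult_mono) auto
  then show ?thesis using that [of j] j l by simp
qed

text \<open>A single power \<open>p\<^sup>b\<close> in the middle \<open>(6/5, 5/3)\<close> of a dyadic interval suffices to cut it into two pieces of
ratio below \<open>5/3\<close>. If \<open>p/2\<^sup>d\<close> itself is not there, then \<open>p/2\<^sup>d\<close> or \<open>2\<^sup>d\<^sup>+\<^sup>1/p\<close> lies in \<open>(1, 6/5]\<close>,
and the first power of that ratio beyond \<open>6/5\<close> is at most \<open>(6/5)\<^sup>2 < 5/3\<close>.\<close>
lemma odd_power_near_power_of_2:
  assumes "odd p" "p \<ge> 3"
  obtains q b e where "q = p ^ b" "6 * 2 ^ e < 5 * real q" "3 * real q < 5 * 2 ^ e"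
proof -
  obtain d where d: "2 ^ d \<le> p" "p < 2 ^ (d + 1)" using ex_power_ivl1 [of 2 p] assms(2) by auto
  have "d \<noteq> 0" using d assms(2) by (cases d) auto
  then have "2 ^ d \<noteq> p" using assms(1) by auto
  then have d1: "(2::nat) ^ d < p" using d(1) by simp
  have "real (2 ^ d) < real p" "real p < real (2 ^ (d + 1))" using d1 d(2) by (simp_all only: of_nat_less_iff)
  then have rd: "2 ^ d < real p" "real p < 2 * 2 ^ d" by simp_all
  have interval: "6 * t < 5 * q" "3 * q < 5 * t" if "t > 0" "6 / 5 < q / t" "q / t \<le> 36 / 25" for q t :: real
    using that by (simp_all add: field_simps)
  consider "real p / 2 ^ d \<le> 6 / 5" | "6 / 5 < real p / 2 ^ d" "real p / 2 ^ d < 5 / 3"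
    | "5 / 3 \<le> real p / 2 ^ d" by linarith
  then show ?thesis
  proof cases
    case 1
    have "1 < real p / 2 ^ d" using rd(1) by simp
    then obtain j where j: "6 / 5 < (real p / 2 ^ d) ^ j" "(real p / 2 ^ d) ^ j \<le> 36 / 25"
      using 1 by (rule first_power_exceeding)
    have eq: "(real p / 2 ^ d) ^ j = real (p ^ j) / 2 ^ (d * j)" by (simp add: power_divide power_mult)
    have "6 * 2 ^ (d * j) < 5 * real (p ^ j)" "3 * real (p ^ j) < 5 * 2 ^ (d * j)"
      using interval [OF _ j [unfolded eq]] by simp_all
    then show ?thesis using that by blast
  next
    case 2
    then have "6 * 2 ^ d < 5 * real (p ^ 1)" "3 * real (p ^ 1) < 5 * 2 ^ d" by (simp_all add: field_simps)
    then show ?thesis using that by blast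
  next
    case 3
    have "1 < 2 * 2 ^ d / real p" "2 * 2 ^ d / real p \<le> 6 / 5" using 3 rd assms(2) by (simp_all add: field_simps)
    then obtain j where j: "j \<ge> 1" "6 / 5 < (2 * 2 ^ d / real p) ^ j" "(2 * 2 ^ d / real p) ^ j \<le> 36 / 25"
      by (rule first_power_exceeding)
    \<comment> \<open>The power \<open>p\<^sup>j\<close> lies below \<open>2\<^sup>(\<^sup>d\<^sup>+\<^sup>1\<^sup>)\<^sup>j\<close> by a factor between \<open>6/5\<close> and \<open>36/25\<close>, so the power of 2 below
      \<open>p\<^sup>j\<close> is half of it.\<close>
    define e where "e = (d + 1) * j - 1"
    have "(2 * 2 ^ d :: real) ^ j = 2 ^ ((d + 1) * j)" unfolding power_mult by simp
    also have "(d + 1) * j = Suc e" using j(1) by (simp add: e_def)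
    finally have "(2 * 2 ^ d :: real) ^ j = 2 * 2 ^ e" by simp
    then have "6 / 5 < 2 * 2 ^ e / real (p ^ j)" "2 * 2 ^ e / real (p ^ j) \<le> 36 / 25"
      using j(2,3) by (simp_all add: power_divide)
    moreover have "real (p ^ j) > 0" using assms(2) by simp
    moreover have "6 * t < 5 * q" "3 * q < 5 * t" if "q > 0" "6 / 5 < 2 * t / q" "2 * t / q \<le> 36 / 25" for q t :: real
      using that by (simp_all add: field_simps)
    ultimately have "6 * 2 ^ e < 5 * real (p ^ j)" "3 * real (p ^ j) < 5 * 2 ^ e" by blast+
    then show ?thesis using that by blast
  qed
qed

text \<open>The thresholds \<open>n\<^sub>p(5/3)\<close> are least elements of a set that has to be shown nonempty; otherwise they
would carry no information.\<close>
lemma two_p_smooth_in_interval: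
  assumes "odd p" "p \<ge> 3"
  shows "\<exists>M\<ge>1. \<forall>n\<ge>M. \<exists>a b. even (2 ^ a * p ^ b) \<and> real (2 ^ a * p ^ b) \<in> {real n..<real n * (5 / 3)}"
proof -
  obtain q b e where q: "q = p ^ b" "6 * 2 ^ e < 5 * real q" "3 * real q < 5 * 2 ^ e"
    using odd_power_near_power_of_2 [OF assms] by blast
  have "\<exists>a b. even (2 ^ a * p ^ b) \<and> real (2 ^ a * p ^ b) \<in> {real n..<real n * (5 / 3)}"
    if n: "n \<ge> 2 ^ (e + 2)" for n
  proof -
    have "(2::nat) ^ 1 \<le> 2 ^ (e + 2)" by (intro power_increasing) simp_all
    then have "2 ^ 1 \<le> n" using n by (rule le_trans)
    then have "n \<ge> 2" by simp
    then obtain a where a: "2 ^ a < n" "n \<le> 2 ^ (a + 1)" using ex_power_ivl2 [of 2 n] by auto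
    have "(2::nat) ^ (e + 2) \<le> 2 ^ (a + 1)" using n a(2) by linarith
    then have "e + 2 \<le> a + 1" by (simp only: power_increasing_iff)
    then obtain c where c: "a = e + c" "c \<ge> 1" using le_Suc_ex [of "e + 1" a] by auto
    have "real (2 ^ a) < real n" "real n \<le> real (2 ^ (a + 1))" using a by (simp_all only: of_nat_less_iff of_nat_le_iff)
    then have ra: "2 ^ e * 2 ^ c < real n" "real n \<le> 2 * (2 ^ e * 2 ^ c)"
      unfolding c(1) by (simp_all add: power_add)
    have up: "3 * (real q * 2 ^ c) < 5 * (2 ^ e * 2 ^ c)" "6 * (2 ^ e * 2 ^ c) < 5 * (real q * 2 ^ c)"
      using mult_strict_right_mono [OF q(3), of "2 ^ c"] mult_strict_right_mono [OF q(2), of "2 ^ c"] by simp_all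
    show ?thesis
    proof (cases "n \<le> 2 ^ c * q")
      case True
      then have "real n \<le> 2 ^ c * real q" by (metis of_nat_le_iff of_nat_mult of_nat_numeral of_nat_power)
      moreover have "3 * (real q * 2 ^ c) < 5 * real n" using up(1) ra(1) by linarith
      ultimately have "real (2 ^ c * p ^ b) \<in> {real n..<real n * (5 / 3)}"
        unfolding q(1) [symmetric] by (simp add: mult.commute)
      moreover have "even (2 ^ c * p ^ b)" using c(2) by simp
      ultimately show ?thesis by blast
    next
      case False
      then have "2 ^ c * real q < real n" by (metis not_less of_nat_less_iff of_nat_mult of_nat_numeral of_nat_power)
      then have "6 * (2 ^ e * 2 ^ c) < 5 * real n" using up(2) by (simp only: mult.commute [of "real q"])
      then have "real (2 ^ (a + 1) * p ^ 0) \<in> {real n..<real n * (5 / 3)}"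
        using ra(2) unfolding c(1) by (simp add: power_add mult.commute)
      moreover have "even (2 ^ (a + 1) * p ^ 0)" by simp
      ultimately show ?thesis by blast
    qed
  qed
  moreover have "(2::nat) ^ (e + 2) \<ge> 1" by simp
  ultimately show ?thesis by blast
qed

lemma n_even_property:
  assumes "odd p" "p \<ge> 3" "n \<ge> n_even p (5 / 3)"
  shows "\<exists>a b. even (2 ^ a * p ^ b) \<and> real (2 ^ a * p ^ b) \<in> {real n..<real n * (5 / 3)}"
  using LeastI_ex [OF two_p_smooth_in_interval [OF assms(1,2)]] assms(3) unfolding n_even_def by blast

lemma n_any_property:
  assumes "odd p" "p \<ge> 3" "n \<ge> n_any p (5 / 3)"
  shows "\<exists>a b. real (2 ^ a * p ^ b) \<in> {real n..<real n * (5 / 3)}"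
proof -
  have "\<exists>M\<ge>1. \<forall>n\<ge>M. \<exists>a b. real (2 ^ a * p ^ b) \<in> {real n..<real n * (5 / 3)}"
    using two_p_smooth_in_interval [OF assms(1,2)] by blast
  from LeastI_ex [OF this] show ?thesis using assms(3) unfolding n_any_def by blast
qed

text \<open>An element of \<open>\<S>\<^sub>k\<^sub>,\<^sub>n\<close> below \<open>5n/3\<close> precedes all exceptional moduli.\<close>
lemma Least_targets_eq_Least_setS:
  assumes "s \<in> setS k n" "3 * s < 5 * n"
  shows "(LEAST m. m \<in> targets k n) = (LEAST m. m \<in> setS k n)"
proof (rule Least_equality)
  show "(LEAST m. m \<in> setS k n) \<in> targets k n" using LeastI [of "\<lambda>m. m \<in> setS k n", OF assms(1)] by (simp add: targets_def)
  fix x assume "x \<in> targets k n"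
  then consider "x \<in> setS k n" | "x \<in> times_5_targets k n" by (auto simp: targets_def split: if_splits)
  then show "(LEAST m. m \<in> setS k n) \<le> x"
  proof cases
    case 2
    have "(LEAST m. m \<in> setS k n) \<le> s" by (rule Least_le [of "\<lambda>m. m \<in> setS k n", OF assms(1)])
    also have "s \<le> x" using 2 assms(2) by (auto simp: times_5_targets_def)
    finally show ?thesis .
  qed (rule Least_le)
qed

lemma targets_mod_5_1:
  assumes "[k = 1] (mod 3)" "[k = 1] (mod 5)"
  shows "targets k n = setS k n \<union> {m \<in> setB5 k. real m \<ge> 5 * real n / 3}"
proof -
  have "\<not> [k = 3] (mod 5)" using assms(2) by (simp add: cong_def)
  moreover have "real m \<ge> 5 * real n / 3 \<longleftrightarrow> 5 * n \<le> 3 * m" for m by linarith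
  ultimately have "times_5_targets k n = {m \<in> setB5 k. real m \<ge> 5 * real n / 3}"
    unfolding times_5_targets_def setB5_def by (auto simp del: power_Suc) (metis Suc_le_D One_nat_def)
  then show ?thesis using assms by (simp add: targets_def)
qed

lemma targets_mod_5_3:
  assumes "[k = 1] (mod 3)" "[k = 3] (mod 5)"
  shows "targets k n = setS k n \<union> {m \<in> setA5 k \<union> setB5 k. real m \<ge> 5 * real n / 3}"
proof -
  have "real m \<ge> 5 * real n / 3 \<longleftrightarrow> 5 * n \<le> 3 * m" for m by linarith
  then have "times_5_targets k n = {m \<in> setA5 k \<union> setB5 k. real m \<ge> 5 * real n / 3}"
    unfolding times_5_targets_def setB5_def setA5_def using assms(2) by (auto simp del: power_Suc) (metis Suc_le_D One_nat_def)+
  then show ?thesis using assms by (simp add: targets_def)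
qed

section \<open>The discriminator of the sequence\<close>

theorem theorem3:
  fixes k :: nat
  assumes "k \<ge> 1"
  shows "(\<not> [k = 1] (mod 3) \<longrightarrow>
            (\<forall>n\<ge>1. discriminator k n = (LEAST m. m \<in> setS k n)))
       \<and> ([k = 1] (mod 3) \<and> \<not> [k = 2] (mod 5) \<and> \<not> [k = 6] (mod 25) \<and> \<not> [k = 18] (mod 25) \<longrightarrow>
            (\<forall>n\<ge>1.
               ([k = 0] (mod 5) \<or> [k = 4] (mod 5) \<longrightarrow>
                  discriminator k n = (LEAST m. m \<in> setS k n))
             \<and> ([k = 1] (mod 5) \<longrightarrow>
                  discriminator k n =
                    (LEAST m. m \<in> setS k n \<union> {m \<in> setB5 k. real m \<ge> 5 * real n / 3}))
             \<and> ([k = 3] (mod 5) \<longrightarrow>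
                  discriminator k n =
                    (LEAST m. m \<in> setS k n \<union> {m \<in> setA5 k \<union> setB5 k. real m \<ge> 5 * real n / 3}))))
       \<and> ([k = 1] (mod 3) \<and> ([k = 1] (mod 5) \<or> [k = 3] (mod 5))
            \<and> \<not> [k = 6] (mod 25) \<and> \<not> [k = 18] (mod 25) \<and> k > 1 \<longrightarrow>
            (\<forall>n\<ge>1. \<forall>p. prime p \<and> odd p \<and> p dvd k * (k + 1) \<and> n \<ge> n_even p (5 / 3) \<longrightarrow>
               discriminator k n = (LEAST m. m \<in> setS k n))
          \<and> (odd k \<longrightarrow>
              (\<forall>n\<ge>1. \<forall>p. prime p \<and> odd p \<and> p dvd k \<and> n \<ge> n_any p (5 / 3) \<longrightarrow>
                 discriminator k n = (LEAST m. m \<in> setS k n))))"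
proof (intro conjI impI allI)
  fix n :: nat assume k: "\<not> [k = 1] (mod 3)" and n: "n \<ge> 1"
  then show "discriminator k n = (LEAST m. m \<in> setS k n)"
    using discriminator_eq_Least_targets [OF n, of k] by (simp add: targets_def)
next
  assume k: "[k = 1] (mod 3) \<and> \<not> [k = 2] (mod 5) \<and> \<not> [k = 6] (mod 25) \<and> \<not> [k = 18] (mod 25)"
  fix n :: nat assume n: "n \<ge> 1"
  have D: "discriminator k n = (LEAST m. m \<in> targets k n)"
    using discriminator_eq_Least_targets [OF n] k by blast
  show "discriminator k n = (LEAST m. m \<in> setS k n)" if "[k = 0] (mod 5) \<or> [k = 4] (mod 5)"
  proof -
    have "\<not> [k = 1] (mod 5)" "\<not> [k = 3] (mod 5)" using that by (auto simp: cong_def)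
    then show ?thesis unfolding D by (simp add: targets_def)
  qed
  show "discriminator k n = (LEAST m. m \<in> setS k n \<union> {m \<in> setB5 k. real m \<ge> 5 * real n / 3})"
    if "[k = 1] (mod 5)"
    unfolding D using targets_mod_5_1 k that by simp
  show "discriminator k n = (LEAST m. m \<in> setS k n \<union> {m \<in> setA5 k \<union> setB5 k. real m \<ge> 5 * real n / 3})"
    if "[k = 3] (mod 5)"
    unfolding D using targets_mod_5_3 k that by simp
next
  assume k: "[k = 1] (mod 3) \<and> ([k = 1] (mod 5) \<or> [k = 3] (mod 5))
            \<and> \<not> [k = 6] (mod 25) \<and> \<not> [k = 18] (mod 25) \<and> k > 1"
  have D: "discriminator k n = (LEAST m. m \<in> setS k n)"
    if n: "n \<ge> 1" and s: "s \<in> setA k \<union> setB k" "real s \<in> {real n..<real n * (5 / 3)}" for n s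
  proof -
    have "\<not> [k = 2] (mod 5)" using k by (auto simp: cong_def)
    then have "discriminator k n = (LEAST m. m \<in> targets k n)"
      using discriminator_eq_Least_targets [OF n] k by blast
    also have "\<dots> = (LEAST m. m \<in> setS k n)"
    proof (rule Least_targets_eq_Least_setS)
      have "real s \<ge> real n" "3 * real s < 5 * real n" using s(2) by simp_all
      then show "s \<in> setS k n" "3 * s < 5 * n" using s(1) by (simp_all add: setS_def)
    qed
    finally show ?thesis .
  qed
  have nine: "\<not> 9 dvd U k 3"
  proof -
    have "k mod 3 = 1" using k by (simp add: cong_def)
    then have "k mod 9 \<noteq> 6" "k mod 9 \<noteq> 2" by presburger+
    then show ?thesis unfolding nine_dvd_U_3 by (simp add: cong_def)
  qed
  have odd_prime: "p \<ge> 3" if "prime p" "odd p" for p :: nat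
    using that prime_ge_2_nat [of p] by (cases "p = 2") auto
  have divisors: "q = 2 \<or> q = p" if "prime q" "prime p" "q dvd 2 ^ a * p ^ b" for p q a b :: nat
    using that by (metis prime_dvd_mult_iff prime_dvd_power primes_dvd_imp_eq two_is_prime_nat)
  have B: "2 ^ a * p ^ b \<in> setB k" if "prime p" "p dvd k * (k + 1)" "even (2 ^ a * p ^ b)" for a b p :: nat
  proof -
    have "2 dvd k * (k + 1)" by simp
    then have "\<forall>q. prime q \<longrightarrow> q dvd 2 ^ a * p ^ b \<longrightarrow> q dvd k * (k + 1)"
      using divisors [OF _ that(1)] that(2) by blast
    moreover have "2 ^ a * p ^ b \<ge> 1" using prime_gt_0_nat [OF that(1)] by (simp add: Suc_le_eq)
    ultimately show ?thesis using nine that(3) unfolding setB_iff by blast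
  qed
  show "discriminator k n = (LEAST m. m \<in> setS k n)"
    if n: "n \<ge> 1" and p: "prime p \<and> odd p \<and> p dvd k * (k + 1) \<and> n \<ge> n_even p (5 / 3)" for n p
  proof -
    obtain a b where "even (2 ^ a * p ^ b)" "real (2 ^ a * p ^ b) \<in> {real n..<real n * (5 / 3)}"
      using n_even_property [of p n] odd_prime p by blast
    then show ?thesis using D [OF n] B p by blast
  qed
  show "discriminator k n = (LEAST m. m \<in> setS k n)"
    if "odd k" and n: "n \<ge> 1" and p: "prime p \<and> odd p \<and> p dvd k \<and> n \<ge> n_any p (5 / 3)" for n p
  proof -
    obtain a b where ab: "real (2 ^ a * p ^ b) \<in> {real n..<real n * (5 / 3)}"
      using n_any_property [of p n] odd_prime p by blast
    have "2 ^ a * p ^ b \<in> setA k \<union> setB k"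
    proof (cases "even (2 ^ a * p ^ b)")
      case True
      then show ?thesis using B p dvd_mult2 by blast
    next
      case False
      have "q dvd k" if "prime q" "q dvd 2 ^ a * p ^ b" for q
        using divisors [OF that(1) _ that(2)] p False that(2) by blast
      moreover have "2 ^ a * p ^ b \<ge> 1" using p by (simp add: Suc_le_eq prime_gt_0_nat)
      ultimately have "2 ^ a * p ^ b \<in> setA k" using nine False setA_iff by metis
      then show ?thesis by (rule UnI1)
    qed
    then show ?thesis using D [OF n _ ab] by blast
  qed
qed

end
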